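(* Let $F$ be an algebraically closed field and let $\mathfrak{g}=\langle x\rangle\ltimes\mathfrak{a}$ be a finite dimensional Lie algebra over $F$, where $\mathfrak{a}$ is an abelian ideal on which $\mathrm{ad}\,x$ acts diagonalizably. Assume that $1$ is an eigenvalue of $\mathrm{ad}\,x$ acting on $\mathfrak{a}$ and let $v\in\mathfrak{a}$ be a corresponding eigenvector. Let $m>1$ be an integer and suppose that $\mathrm{char}(F)=0$ or $\mathrm{char}(F)=p\ge m$. Given $\alpha\in F$, set $D=\mathrm{diag}(\alpha,\alpha-1,\dots,\alpha-(m-1))$ and $J=J_m(0)$, and let $f^i:\mathfrak{a}(i)\to F$, $0\le i<m$, be linear functionals subject only to $f^1(v)=1$. Then the linear map $R:\mathfrak{g}\to\mathfrak{gl}(m)$ defined by $R(x)=D$, $R(u)=f^i(u)J^i$ for $u\in\mathfrak{a}(i)$ and $0\le i<m$, and $R(u)=0$ for $u\in\mathfrak{a}(\delta)$ with $\delta\notin\{0,1,\dots,m-1\}$, is a representation which yields an admissible uniserial $\mathfrak{g}$-module $U$ of composition length $m$ upon which $[\mathfrak{g},\mathfrak{g}]$ does not act trivially. Moreover, any modification whatsoever to $m,\alpha,f^0,\dots,f^{m-1}$ that keeps $f^1(v)=1$ produces a $\mathfrak{g}$-module non-isomorphic to $U$; that is, two such data $(m,\alpha,f^0,\dots,f^{m-1})$ (with the same $x$ and $v$, each consisting of an integer $m>1$ such that $\mathrm{char}(F)=0$ or $\mathrm{char}(F)=p\ge m$, a scalar $\alpha\in F$, and linear functionals $f^i:\mathfrak{a}(i)\to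 F$, $0\le i<m$, with $f^1(v)=1$) yield isomorphic $\mathfrak{g}$-modules only if they coincide.
   Context: A $\mathfrak{g}$-module is admissible if every element of $[\mathfrak{g},\mathfrak{g}]$ acts on it via a nilpotent operator. A module is uniserial if it has a unique composition series. For $\delta\in F$, $\mathfrak{a}(\delta)=\{u\in\mathfrak{a}\,|\,[x,u]=\delta u\}$ (possibly zero); integers are viewed as elements of $F$ through the canonical map $\mathbb{Z}\to F$. $J_m(0)$ is the $m\times m$ upper triangular Jordan block with eigenvalue $0$, and $J^0=I$. *)

theory Defs
  imports "Jordan_Normal_Form.Jordan_Normal_Form" "Jordan_Normal_Form.VS_Connect" "HOL-Algebra.AbelCoset"
begin

locale lie_algebra = vector_space scale
  for scale :: "'f::field \<Rightarrow> 'g::ab_group_add \<Rightarrow> 'g" +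
  fixes br :: "'g \<Rightarrow> 'g \<Rightarrow> 'g"
  assumes br_add_left: "br (y + z) w = br y w + br z w"
    and br_scale_left: "br (scale c y) w = scale c (br y w)"
    and br_add_right: "br w (y + z) = br w y + br w z"
    and br_scale_right: "br w (scale c y) = scale c (br w y)"
    and br_self: "br y y = 0"
    and jacobi: "br y (br z w) + br z (br w y) + br w (br y z) = 0"
begin

definition finite_dim :: bool where
  "finite_dim \<longleftrightarrow> (\<exists>B. finite B \<and> span B = UNIV)"

definition derived_algebra :: "'g set" where
  "derived_algebra = span {br y z | y z. True}"

definition abelian_ideal :: "'g set \<Rightarrow> bool" where
  "abelian_ideal \<aa> \<longleftrightarrow> module.subspace scale \<aa> \<and>
     (\<forall>y. \<forall>u\<in>\<aa>. br y u \<in> \<aa>) \<and> (\<forall>u\<in>\<aa>. \<forall>w\<in>\<aa>. br u w = 0)"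

definition semidirect :: "'g \<Rightarrow> 'g set \<Rightarrow> bool" where
  "semidirect x \<aa> \<longleftrightarrow> abelian_ideal \<aa> \<and>
     span {x} \<inter> \<aa> = {0} \<and> (\<forall>y. \<exists>t\<in>span {x}. \<exists>u\<in>\<aa>. y = t + u)"

definition ad_diagonalizable_on :: "'g \<Rightarrow> 'g set \<Rightarrow> bool" where
  "ad_diagonalizable_on x \<aa> \<longleftrightarrow>
     (\<exists>B. \<not> dependent B \<and> span B = \<aa> \<and> (\<forall>b\<in>B. \<exists>\<delta>. br x b = scale \<delta> b))"

definition ad_eigenspace :: "'g \<Rightarrow> 'g set \<Rightarrow> 'f \<Rightarrow> 'g set" where
  "ad_eigenspace x \<aa> \<delta> = {u \<in> \<aa>. br x u = scale \<delta> u}"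

text \<open>Only the values of \<open>f\<close> on \<open>S\<close> matter: \<open>f\<close> stands for a functional with domain \<open>S\<close>.\<close>
definition linear_functional_on :: "'g set \<Rightarrow> ('g \<Rightarrow> 'f) \<Rightarrow> bool" where
  "linear_functional_on S f \<longleftrightarrow>
     (\<forall>u\<in>S. \<forall>w\<in>S. f (u + w) = f u + f w) \<and> (\<forall>c. \<forall>u\<in>S. f (scale c u) = c * f u)"

definition linear_to_mat :: "nat \<Rightarrow> ('g \<Rightarrow> 'f mat) \<Rightarrow> bool" where
  "linear_to_mat m R \<longleftrightarrow> (\<forall>y. R y \<in> carrier_mat m m) \<and>
     (\<forall>y z. R (y + z) = R y + R z) \<and> (\<forall>c y. R (scale c y) = c \<cdot>\<^sub>m R y)"

definition matrix_representation :: "nat \<Rightarrow> ('g \<Rightarrow> 'f mat) \<Rightarrow> bool" where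
  "matrix_representation m R \<longleftrightarrow> linear_to_mat m R \<and>
     (\<forall>y z. R (br y z) = R y * R z - R z * R y)"

end

text \<open>
  The underlying vector space is a record with an explicit carrier, since the dimension of the
  module, and the submodules and subquotients, vary within one statement.
\<close>
locale lie_module = lie_algebra scale br
  for scale :: "'f::field \<Rightarrow> 'g::ab_group_add \<Rightarrow> 'g" and br +
  fixes V :: "('f, 'v) module" (structure) and act :: "'g \<Rightarrow> 'v \<Rightarrow> 'v"
  assumes vs: "vectorspace class_ring V"
    and act_hom: "act y \<in> module_hom class_ring V V"
    and act_add: "w \<in> carrier V \<Longrightarrow> act (y + z) w = act y w \<oplus> act z w"
    and act_scale: "w \<in> carrier V \<Longrightarrow> act (scale c y) w = c \<odot> act y w"
    and act_br: "w \<in> carrier V \<Longrightarrow> act (br y z) w = act y (act z w) \<ominus> act z (act y w)"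

definition lie_submodule ::
    "('f::field, 'v) module \<Rightarrow> ('g \<Rightarrow> 'v \<Rightarrow> 'v) \<Rightarrow> 'v set \<Rightarrow> bool" where
  "lie_submodule V act W \<longleftrightarrow> subspace class_ring W V \<and> (\<forall>y. \<forall>w\<in>W. act y w \<in> W)"

text \<open>
  The quotient \<open>V/W\<close> on the set of cosets. The unions below are the cosets
  \<open>c\<cdot>w + W\<close> and \<open>y\<cdot>w + W\<close> for any representative \<open>w\<close> of \<open>X\<close>;
  the ring fields of the record are meaningless for a module.
\<close>
definition quotient_space :: "('f::field, 'v) module \<Rightarrow> 'v set \<Rightarrow> ('f, 'v set) module" where
  "quotient_space V W = \<lparr>carrier = a_rcosets\<^bsub>V\<^esub> W, mult = undefined, one = undefined,
     zero = W, add = (\<lambda>X Y. X <+>\<^bsub>V\<^esub> Y),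
     smult = (\<lambda>c X. \<Union>w\<in>X. W +>\<^bsub>V\<^esub> (c \<odot>\<^bsub>V\<^esub> w))\<rparr>"

definition quotient_act ::
    "('f::field, 'v) module \<Rightarrow> ('g \<Rightarrow> 'v \<Rightarrow> 'v) \<Rightarrow> 'v set \<Rightarrow> 'g \<Rightarrow> 'v set \<Rightarrow> 'v set" where
  "quotient_act V act W y X = (\<Union>w\<in>X. W +>\<^bsub>V\<^esub> act y w)"

definition irreducible_module :: "('f::field, 'v) module \<Rightarrow> ('g \<Rightarrow> 'v \<Rightarrow> 'v) \<Rightarrow> bool" where
  "irreducible_module V act \<longleftrightarrow> carrier V \<noteq> {\<zero>\<^bsub>V\<^esub>} \<and>
     (\<forall>W. lie_submodule V act W \<longrightarrow> W = {\<zero>\<^bsub>V\<^esub>} \<or> W = carrier V)"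

text \<open>A series \<open>0 = W\<^sub>0 \<subseteq> W\<^sub>1 \<subseteq> \<dots> \<subseteq> W\<^sub>l = V\<close> is the list of its
  \<open>l + 1\<close> terms.\<close>
definition composition_series ::
    "('f::field, 'v) module \<Rightarrow> ('g \<Rightarrow> 'v \<Rightarrow> 'v) \<Rightarrow> 'v set list \<Rightarrow> bool" where
  "composition_series V act Ws \<longleftrightarrow> Ws \<noteq> [] \<and> hd Ws = {\<zero>\<^bsub>V\<^esub>} \<and> last Ws = carrier V \<and>
     (\<forall>W\<in>set Ws. lie_submodule V act W) \<and>
     (\<forall>i. Suc i < length Ws \<longrightarrow> Ws ! i \<subseteq> Ws ! Suc i \<and>
        irreducible_module (quotient_space (V\<lparr>carrier := Ws ! Suc i\<rparr>) (Ws ! i))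
          (quotient_act (V\<lparr>carrier := Ws ! Suc i\<rparr>) act (Ws ! i)))"

definition uniserial :: "('f::field, 'v) module \<Rightarrow> ('g \<Rightarrow> 'v \<Rightarrow> 'v) \<Rightarrow> bool" where
  "uniserial V act \<longleftrightarrow> (\<exists>!Ws. composition_series V act Ws)"

definition has_composition_length ::
    "('f::field, 'v) module \<Rightarrow> ('g \<Rightarrow> 'v \<Rightarrow> 'v) \<Rightarrow> nat \<Rightarrow> bool" where
  "has_composition_length V act l \<longleftrightarrow> (\<exists>Ws. composition_series V act Ws \<and> length Ws = Suc l)"

definition (in lie_algebra) admissible ::
    "('f, 'v) module \<Rightarrow> ('g \<Rightarrow> 'v \<Rightarrow> 'v) \<Rightarrow> bool" where
  "admissible V act \<longleftrightarrow>
     (\<forall>y\<in>derived_algebra. \<exists>k. \<forall>w\<in>carrier V. (act y ^^ k) w = \<zero>\<^bsub>V\<^esub>)"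

definition isomorphic_modules ::
    "('f::field, 'v) module \<Rightarrow> ('g \<Rightarrow> 'v \<Rightarrow> 'v) \<Rightarrow> ('f, 'w) module \<Rightarrow> ('g \<Rightarrow> 'w \<Rightarrow> 'w) \<Rightarrow> bool"
  where
  "isomorphic_modules V act V' act' \<longleftrightarrow>
     (\<exists>\<phi>. \<phi> \<in> module_hom class_ring V V' \<and> bij_betw \<phi> (carrier V) (carrier V') \<and>
        (\<forall>y. \<forall>w\<in>carrier V. \<phi> (act y w) = act' y (\<phi> w)))"

definition mat_act :: "('g \<Rightarrow> 'f::field mat) \<Rightarrow> 'g \<Rightarrow> 'f vec \<Rightarrow> 'f vec" where
  "mat_act R y w = R y *\<^sub>v w"

context lie_algebra
begin

text \<open>Since \<open>CHAR('f)\<close> is \<open>0\<close> or prime, the second conjunct says that the characteristic is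
  \<open>0\<close> or a prime \<open>p \<ge> m\<close>. Of \<open>f\<close> only the values \<open>f i u\<close> with \<open>i < m\<close> and
  \<open>u \<in> \<aa>(i)\<close> are part of the data.\<close>
definition valid_data :: "'g \<Rightarrow> 'g set \<Rightarrow> 'g \<Rightarrow> nat \<Rightarrow> (nat \<Rightarrow> 'g \<Rightarrow> 'f) \<Rightarrow> bool" where
  "valid_data x \<aa> v m f \<longleftrightarrow> 1 < m \<and> (CHAR('f) = 0 \<or> m \<le> CHAR('f)) \<and>
     (\<forall>i<m. linear_functional_on (ad_eigenspace x \<aa> (of_nat i)) (f i)) \<and> f 1 v = 1"

definition is_R_map ::
    "'g \<Rightarrow> 'g set \<Rightarrow> nat \<Rightarrow> 'f \<Rightarrow> (nat \<Rightarrow> 'g \<Rightarrow> 'f) \<Rightarrow> ('g \<Rightarrow> 'f mat) \<Rightarrow> bool" where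
  "is_R_map x \<aa> m \<alpha> f R \<longleftrightarrow> linear_to_mat m R \<and>
     R x = mat_diag m (\<lambda>k. \<alpha> - of_nat k) \<and>
     (\<forall>i<m. \<forall>u\<in>ad_eigenspace x \<aa> (of_nat i). R u = f i u \<cdot>\<^sub>m (jordan_block m 0 ^\<^sub>m i)) \<and>
     (\<forall>\<delta>. \<delta> \<notin> of_nat ` {..<m} \<longrightarrow> (\<forall>u\<in>ad_eigenspace x \<aa> \<delta>. R u = 0\<^sub>m m m))"

end

end

theory Submission
  imports Defs "HOL-Number_Theory.Cong"
begin

text \<open>
  Choose a basis \<open>B\<close> of \<open>\<aa>\<close> of eigenvectors of \<open>ad x\<close>; then \<open>x\<close> and \<open>B\<close> form a basis of the Lie
  algebra, and \<open>R\<close> is the linear extension of its prescribed values there. This is consistent with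
  the prescription on the whole of each eigenspace, because an eigenvector is a combination of the
  members of \<open>B\<close> with its own eigenvalue, and because the bound on the characteristic keeps
  \<open>0, \<dots>, m - 1\<close> distinct in the field, so that no eigenspace receives two prescriptions
  (\<open>ad_eigenspace_eq_span\<close>, \<open>of_nat_inj_below_CHAR\<close>). That \<open>R\<close> is a representation has to be
  checked on the basis only, where it says that powers of \<open>J\<close> commute and that
  \<open>D J\<^sup>i - J\<^sup>i D = i J\<^sup>i\<close>.

  All matrices \<open>R y\<close> are upper triangular, so commutators, and with them the derived algebra, act by
  strictly upper triangular and hence nilpotent matrices. On the other hand \<open>R v = J\<close>, and the
  subspaces stable under a single nilpotent Jordan block are only the flag
  \<open>0 = W\<^sub>0 \<subset> W\<^sub>1 \<subset> \<dots> \<subset> W\<^sub>m\<close> of its kernels (\<open>jordan_block_invariant_subspace\<close>). The flag is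
  stable under upper triangular matrices, so the submodules form a chain. The only composition series
  is therefore the flag itself (\<open>composition_series_flag_iff\<close>), by the correspondence between
  submodules of a quotient and intermediate submodules (\<open>irreducible_quotient_iff\<close>).

  An isomorphism \<open>\<phi>\<close> intertwines the two actions of \<open>v\<close>, which are Jordan blocks of sizes \<open>m\<close>
  and \<open>m'\<close>; comparing nilpotency indices gives \<open>m' = m\<close>. The kernel of \<open>v\<close> is the line of
  \<open>e\<^sub>0\<close>, on which \<open>x\<close> acts by \<open>\<alpha>\<close>, so \<open>\<alpha>' = \<alpha>\<close>. Finally \<open>J\<^sup>i e\<^sub>i = e\<^sub>0\<close>, so for
  \<open>u \<in> \<aa>(i)\<close> the vector \<open>u e\<^sub>i = f\<^sup>i(u) v\<^sup>i e\<^sub>i\<close> has the image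
  \<open>f\<^sup>i(u) \<phi>(e\<^sub>0)\<close> and also \<open>f'\<^sup>i(u) \<phi>(e\<^sub>0)\<close>, whence \<open>f'\<^sup>i(u) = f\<^sup>i(u)\<close>.
\<close>

section \<open>Quotient modules and composition series\<close>

text \<open>
  A family of additive operators, whatever indexes them: additivity is what lets an operator pass to
  the cosets of a stable subspace.
\<close>
locale linear_action = vectorspace "class_ring :: 'f ring" V
  for V :: "('f::field, 'v) module" (structure) +
  fixes act :: "'g \<Rightarrow> 'v \<Rightarrow> 'v"
  assumes act_closed: "w \<in> carrier V \<Longrightarrow> act y w \<in> carrier V"
    and act_plus: "w \<in> carrier V \<Longrightarrow> w' \<in> carrier V \<Longrightarrow> act y (w \<oplus> w') = act y w \<oplus> act y w'"
begin

lemma mem_class_ring [simp]: "c \<in> carrier (class_ring :: 'f ring)"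
  by (simp add: class_ring_simps)

text \<open>
  The simplifier rewrites the operations of \<open>class_ring\<close> to those of the field, so the module
  axioms are needed in that form.
\<close>
lemmas smult_rules = smult_l_distr[unfolded class_ring_simps] smult_r_distr
  smult_assoc1[unfolded class_ring_simps] smult_one[unfolded class_ring_simps]

lemma subspace_abelian_subgroup:
  assumes "subspace class_ring W V"
  shows "abelian_subgroup W V"
proof -
  interpret W: submodule class_ring W V using assms by (rule is_module)
  have neg: "\<ominus> a \<in> W" if a: "a \<in> W" for a
  proof -
    have "\<ominus> a = (\<ominus>\<^bsub>class_ring\<^esub> \<one>\<^bsub>class_ring\<^esub>) \<odot> a"
      using a W.subset by (intro smult_minus_1[symmetric]) auto
    also have "\<dots> \<in> W" using a by (intro W.smult_closed) auto
    finally show ?thesis .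
  qed
  have "W \<noteq> {}" using W.zero_closed by blast
  then have "subgroup W (add_monoid V)"
    using W.subset neg by (intro add.subgroupI) (auto simp flip: a_inv_def)
  then show ?thesis
    by (intro abelian_subgroupI3 additive_subgroupI abelian_group_axioms)
qed

text \<open>
  The union defining scalar multiplication on a quotient runs over all representatives; linearity
  makes every one of them contribute the same coset.
\<close>
lemma coset_smult:
  assumes W: "subspace class_ring W V" and a: "a \<in> carrier V"
  shows "(\<Union>w\<in>W +> a. W +> (c \<odot> w)) = W +> (c \<odot> a)"
proof -
  interpret W: submodule class_ring W V using W by (rule is_module)
  interpret A: abelian_subgroup W V using W by (rule subspace_abelian_subgroup)
  have "W +> (c \<odot> w) = W +> (c \<odot> a)" if w: "w \<in> W +> a" for w
  proof -
    obtain h where h: "h \<in> W" "w = h \<oplus> a" using w by (auto simp: a_r_coset_def')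
    have hc: "h \<in> carrier V" using h W.subset by auto
    have "c \<odot> w = c \<odot> h \<oplus> c \<odot> a" using h hc a by (simp add: smult_r_distr class_ring_simps)
    moreover have "c \<odot> h \<in> W" using h by (intro W.smult_closed) (auto simp: class_ring_simps)
    ultimately have "c \<odot> w \<in> W +> (c \<odot> a)" by (auto simp: a_r_coset_def')
    then show ?thesis using a by (intro A.a_repr_independence'[symmetric]) (auto simp: class_ring_simps)
  qed
  moreover have "a \<in> W +> a" using a by (rule A.a_rcos_self)
  ultimately show ?thesis by blast
qed

lemma coset_act:
  assumes W: "lie_submodule V act W" and a: "a \<in> carrier V"
  shows "quotient_act V act W y (W +> a) = W +> act y a"
proof -
  have sub: "subspace class_ring W V" using W by (simp add: lie_submodule_def)
  interpret W: submodule class_ring W V using sub by (rule is_module)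
  interpret A: abelian_subgroup W V using sub by (rule subspace_abelian_subgroup)
  have "W +> act y w = W +> act y a" if w: "w \<in> W +> a" for w
  proof -
    obtain h where h: "h \<in> W" "w = h \<oplus> a" using w by (auto simp: a_r_coset_def')
    have hc: "h \<in> carrier V" using h W.subset by auto
    have "act y w = act y h \<oplus> act y a" using h hc a by (simp add: act_plus)
    moreover have "act y h \<in> W" using h W by (simp add: lie_submodule_def)
    ultimately have "act y w \<in> W +> act y a" by (auto simp: a_r_coset_def')
    then show ?thesis using a act_closed by (intro A.a_repr_independence'[symmetric]) auto
  qed
  moreover have "a \<in> W +> a" using a by (rule A.a_rcos_self)
  ultimately show ?thesis unfolding quotient_act_def by blast
qed

lemma carrier_quotient_space: "carrier (quotient_space V W) = (\<lambda>a. W +> a) ` carrier V"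
  by (auto simp: quotient_space_def A_RCOSETS_def')

lemma quotient_space_add:
  assumes W: "subspace class_ring W V" and "a \<in> carrier V" "b \<in> carrier V"
  shows "(W +> a) \<oplus>\<^bsub>quotient_space V W\<^esub> (W +> b) = W +> (a \<oplus> b)"
proof -
  interpret A: abelian_subgroup W V using W by (rule subspace_abelian_subgroup)
  show ?thesis using assms by (simp add: quotient_space_def A.a_rcos_sum)
qed

lemma quotient_space_smult:
  assumes "subspace class_ring W V" and "a \<in> carrier V"
  shows "c \<odot>\<^bsub>quotient_space V W\<^esub> (W +> a) = W +> (c \<odot> a)"
  using coset_smult[OF assms] by (simp add: quotient_space_def)

lemma coset_eq_zero_iff:
  assumes W: "subspace class_ring W V" and a: "a \<in> carrier V"
  shows "W +> a = W \<longleftrightarrow> a \<in> W"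
proof -
  interpret A: abelian_subgroup W V using W by (rule subspace_abelian_subgroup)
  show ?thesis
    using a A.a_rcos_self[OF a] a_coset_join2[OF a A.a_subgroup] by auto
qed

lemma quotient_space_vectorspace:
  assumes W: "subspace class_ring W V"
  shows "vectorspace class_ring (quotient_space V W)"
proof -
  interpret W: submodule class_ring W V using W by (rule is_module)
  note simps = carrier_quotient_space quotient_space_add[OF W] quotient_space_smult[OF W]
  have zero: "\<zero>\<^bsub>quotient_space V W\<^esub> = W +> \<zero>"
    using coset_eq_zero_iff[OF W, of \<zero>] by (simp add: quotient_space_def)
  have neg: "\<exists>b\<in>carrier V. W +> (a \<oplus> b) = W +> \<zero>" if "a \<in> carrier V" for a
    using that by (intro bexI[of _ "\<ominus> a"]) (auto simp: r_neg)
  show ?thesis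
    by (rule vs_criteria)
      (auto simp: simps zero neg M.add.m_ac smult_rules class_ring_simps intro!: class_field)
qed


text \<open>
  The correspondence theorem, applied to maximality: \<open>P \<mapsto> P/W\<close> and the preimage under the
  projection translate between submodules above \<open>W\<close> and submodules of the quotient.
\<close>
lemma irreducible_quotient_iff:
  assumes W: "lie_submodule V act W"
  shows "irreducible_module (quotient_space V W) (quotient_act V act W) \<longleftrightarrow>
    W \<noteq> carrier V \<and> (\<forall>P. lie_submodule V act P \<longrightarrow> W \<subseteq> P \<longrightarrow> P = W \<or> P = carrier V)"
    (is "?irr \<longleftrightarrow> _ \<and> ?max")
proof -
  let ?Q = "quotient_space V W"
  have sub: "subspace class_ring W V" using W by (simp add: lie_submodule_def)
  interpret W: submodule class_ring W V using sub by (rule is_module)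
  interpret A: abelian_subgroup W V using sub by (rule subspace_abelian_subgroup)
  interpret Q: vectorspace class_ring ?Q using sub by (rule quotient_space_vectorspace)
  have zero: "\<zero>\<^bsub>?Q\<^esub> = W" by (simp add: quotient_space_def)
  note coset_zero = coset_eq_zero_iff[OF sub]
  note ops = quotient_space_add[OF sub] quotient_space_smult[OF sub] coset_act[OF W]
  have nontrivial: "carrier ?Q \<noteq> {\<zero>\<^bsub>?Q\<^esub>} \<longleftrightarrow> W \<noteq> carrier V"
  proof
    assume "W \<noteq> carrier V"
    then obtain a where "a \<in> carrier V" "a \<notin> W" using W.subset by auto
    then show "carrier ?Q \<noteq> {\<zero>\<^bsub>?Q\<^esub>}"
      using coset_zero[of a] unfolding carrier_quotient_space zero by auto
  next
    assume *: "carrier ?Q \<noteq> {\<zero>\<^bsub>?Q\<^esub>}"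
    show "W \<noteq> carrier V"
    proof
      assume "W = carrier V"
      then have "carrier ?Q = {W}"
        using coset_zero W.zero_closed unfolding carrier_quotient_space by blast
      then show False using * zero by simp
    qed
  qed
  have image_submodule: "lie_submodule ?Q (quotient_act V act W) ((\<lambda>a. W +> a) ` P)"
    if P: "lie_submodule V act P" "W \<subseteq> P" for P
  proof -
    interpret P: submodule class_ring P V
      using P is_module by (auto simp: lie_submodule_def)
    have Pc: "a \<in> carrier V" if "a \<in> P" for a using that P.subset by auto
    have "W \<in> (\<lambda>a. W +> a) ` P"
      using coset_zero[of \<zero>] W.zero_closed P.zero_closed by (metis image_eqI zero_closed)
    moreover have "act y a \<in> P" if "a \<in> P" for y a using P that by (auto simp: lie_submodule_def)
    ultimately show ?thesis
      unfolding lie_submodule_def subspace_def submodule_def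
      using Pc Q.vectorspace_axioms Q.module_axioms
      by (auto simp: zero ops carrier_quotient_space)
  qed
  have preimage_submodule: "lie_submodule V act {a \<in> carrier V. W +> a \<in> U}"
    if U: "lie_submodule ?Q (quotient_act V act W) U" for U
  proof -
    interpret U: submodule class_ring U ?Q
      using U Q.is_module by (auto simp: lie_submodule_def)
    have "W +> (a \<oplus> b) \<in> U" if "a \<in> carrier V" "b \<in> carrier V" "W +> a \<in> U" "W +> b \<in> U" for a b
      using U.m_closed[OF that(3,4)] that by (simp add: ops)
    moreover have "W +> (c \<odot> a) \<in> U" if "a \<in> carrier V" "W +> a \<in> U" for c a
      using U.smult_closed[OF _ that(2), of c] that by (simp add: ops)
    moreover have "W +> \<zero> \<in> U" using U.zero_closed coset_zero[of \<zero>] by (simp add: zero)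
    moreover have "W +> act y a \<in> U" if "a \<in> carrier V" "W +> a \<in> U" for y a
      using U that ops(3)[of a y] unfolding lie_submodule_def by metis
    ultimately show ?thesis
      unfolding lie_submodule_def subspace_def submodule_def
      using vectorspace_axioms module_axioms by (auto simp: act_closed)
  qed
  have "?irr \<longleftrightarrow> ?max" if ne: "W \<noteq> carrier V"
  proof
    assume irr: ?irr
    show ?max
    proof (intro allI impI)
      fix P assume P: "lie_submodule V act P" "W \<subseteq> P"
      interpret P: submodule class_ring P V
        using P is_module by (auto simp: lie_submodule_def)
      have "(\<lambda>a. W +> a) ` P = {W} \<or> (\<lambda>a. W +> a) ` P = carrier ?Q"
        using irr image_submodule[OF P] by (auto simp: irreducible_module_def zero)
      then show "P = W \<or> P = carrier V"
      proof
        assume "(\<lambda>a. W +> a) ` P = {W}"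
        then have "a \<in> W" if "a \<in> P" for a using that coset_zero[of a] P.subset by blast
        then show ?thesis using P by blast
      next
        assume *: "(\<lambda>a. W +> a) ` P = carrier ?Q"
        have "a \<in> P" if a: "a \<in> carrier V" for a
        proof -
          obtain p where p: "p \<in> P" "W +> a = W +> p"
            using * a unfolding carrier_quotient_space by blast
          then have "a \<in> W +> p" using A.a_rcos_self[OF a] by simp
          then show ?thesis using p P(2) by (auto simp: a_r_coset_def')
        qed
        then show ?thesis using P.subset by blast
      qed
    qed
  next
    assume max: ?max
    show ?irr unfolding irreducible_module_def
    proof (intro conjI allI impI)
      show "carrier ?Q \<noteq> {\<zero>\<^bsub>?Q\<^esub>}" using nontrivial ne by simp
      fix U assume U: "lie_submodule ?Q (quotient_act V act W) U"
      interpret U: submodule class_ring U ?Q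
        using U Q.is_module by (auto simp: lie_submodule_def)
      let ?P = "{a \<in> carrier V. W +> a \<in> U}"
      have U_image: "U = (\<lambda>a. W +> a) ` ?P"
        using U.subset unfolding carrier_quotient_space by blast
      have "W +> a \<in> U" if "a \<in> W" for a
        using that coset_zero[of a] U.zero_closed W.subset by (auto simp: zero)
      then have "W \<subseteq> ?P" using W.subset by auto
      then have "?P = W \<or> ?P = carrier V" using max preimage_submodule[OF U] by blast
      then show "U = {\<zero>\<^bsub>?Q\<^esub>} \<or> U = carrier ?Q"
      proof
        assume P: "?P = W"
        have "U = (\<lambda>a. W +> a) ` W" using U_image unfolding P .
        also have "\<dots> = (\<lambda>a. W) ` W" using coset_zero W.subset by (intro image_cong) auto
        also have "\<dots> = {W}" using W.zero_closed by blast
        finally show ?thesis by (simp add: zero)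
      next
        assume P: "?P = carrier V"
        show ?thesis using U_image unfolding P carrier_quotient_space by simp
      qed
    qed
  qed
  then show ?thesis using nontrivial by (auto simp: irreducible_module_def)
qed

lemma lie_submodule_restrict:
  assumes W: "lie_submodule V act W"
  shows "linear_action (V\<lparr>carrier := W\<rparr>) act"
    and "lie_submodule (V\<lparr>carrier := W\<rparr>) act P \<longleftrightarrow> lie_submodule V act P \<and> P \<subseteq> W"
proof -
  have sub: "subspace class_ring W V" using W by (simp add: lie_submodule_def)
  interpret W: submodule class_ring W V using sub by (rule is_module)
  interpret VW: vectorspace class_ring "V\<lparr>carrier := W\<rparr>" using sub by (rule subspace_is_vs)
  show "linear_action (V\<lparr>carrier := W\<rparr>) act"
    using W W.subset
    by unfold_locales (auto simp: lie_submodule_def act_plus subset_iff)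
  show "lie_submodule (V\<lparr>carrier := W\<rparr>) act P \<longleftrightarrow> lie_submodule V act P \<and> P \<subseteq> W"
    unfolding lie_submodule_def subspace_def submodule_def
    using vectorspace_axioms module_axioms VW.vectorspace_axioms VW.module_axioms W.subset
    by auto
qed

lemma irreducible_subquotient_iff:
  assumes W1: "lie_submodule V act W1" and W2: "lie_submodule V act W2" and le: "W1 \<subseteq> W2"
  shows "irreducible_module (quotient_space (V\<lparr>carrier := W2\<rparr>) W1)
      (quotient_act (V\<lparr>carrier := W2\<rparr>) act W1) \<longleftrightarrow>
    W1 \<noteq> W2 \<and> (\<forall>P. lie_submodule V act P \<longrightarrow> W1 \<subseteq> P \<longrightarrow> P \<subseteq> W2 \<longrightarrow> P = W1 \<or> P = W2)"
proof -
  interpret V2: linear_action "V\<lparr>carrier := W2\<rparr>" act using W2 by (rule lie_submodule_restrict)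
  show ?thesis
    using V2.irreducible_quotient_iff[of W1] W1 le by (auto simp: lie_submodule_restrict(2)[OF W2])
qed

text \<open>
  If the submodules form a strict chain \<open>F 0 \<subset> \<dots> \<subset> F n\<close>, a subquotient \<open>F j / F i\<close> is
  irreducible exactly when \<open>j = i + 1\<close>. A composition series thus starts at \<open>F 0\<close> and can neither
  stay nor skip a step.
\<close>
lemma composition_series_flag_iff:
  assumes submodules: "\<And>W. lie_submodule V act W \<longleftrightarrow> (\<exists>k\<le>n. W = F k)"
    and mono: "\<And>i j. i < j \<Longrightarrow> j \<le> n \<Longrightarrow> F i \<subset> F j"
    and bot: "F 0 = {\<zero>}" and top: "F n = carrier V"
  shows "composition_series V act Ws \<longleftrightarrow> Ws = map F [0..<Suc n]"
proof -
  have le_iff: "F i \<subseteq> F j \<longleftrightarrow> i \<le> j" if "i \<le> n" "j \<le> n" for i j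
    using mono[of i j] mono[of j i] that by (cases i j rule: linorder_cases) auto
  have flag_submodule: "lie_submodule V act (F k)" if "k \<le> n" for k
    using submodules that by blast
  have inj: "F i = F j \<longleftrightarrow> i = j" if "i \<le> n" "j \<le> n" for i j
    using le_iff[of i j] le_iff[of j i] that by auto
  have cover: "irreducible_module (quotient_space (V\<lparr>carrier := F j\<rparr>) (F i))
      (quotient_act (V\<lparr>carrier := F j\<rparr>) act (F i)) \<longleftrightarrow> j = Suc i"
    if ij: "i \<le> j" "j \<le> n" for i j
  proof -
    have "irreducible_module (quotient_space (V\<lparr>carrier := F j\<rparr>) (F i))
      (quotient_act (V\<lparr>carrier := F j\<rparr>) act (F i)) \<longleftrightarrow>
      F i \<noteq> F j \<and> (\<forall>P. lie_submodule V act P \<longrightarrow> F i \<subseteq> P \<longrightarrow> P \<subseteq> F j \<longrightarrow> P = F i \<or> P = F j)"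
      using ij by (intro irreducible_subquotient_iff) (auto simp: flag_submodule le_iff)
    also have "\<dots> \<longleftrightarrow> F i \<noteq> F j \<and>
        (\<forall>k\<le>n. F i \<subseteq> F k \<longrightarrow> F k \<subseteq> F j \<longrightarrow> F k = F i \<or> F k = F j)"
      unfolding submodules by blast
    also have "\<dots> \<longleftrightarrow> i \<noteq> j \<and> (\<forall>k\<le>n. i \<le> k \<longrightarrow> k \<le> j \<longrightarrow> k = i \<or> k = j)"
      using ij by (simp add: inj le_iff)
    also have "\<dots> \<longleftrightarrow> j = Suc i"
    proof
      assume "i \<noteq> j \<and> (\<forall>k\<le>n. i \<le> k \<longrightarrow> k \<le> j \<longrightarrow> k = i \<or> k = j)"
      then show "j = Suc i" using ij by (metis Suc_leI le_SucI le_neq_implies_less le_trans n_not_Suc_n order_refl)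
    qed auto
    finally show ?thesis .
  qed
  show ?thesis
  proof
    assume Ws: "composition_series V act Ws"
    have "Ws ! i = F i \<and> i \<le> n" if "i < length Ws" for i
      using that
    proof (induction i)
      case 0
      then show ?case using Ws bot by (auto simp: composition_series_def hd_conv_nth)
    next
      case (Suc i)
      then have IH: "Ws ! i = F i" "i \<le> n" by auto
      have "lie_submodule V act (Ws ! Suc i)"
        using Ws Suc.prems by (auto simp: composition_series_def)
      then obtain k where k: "k \<le> n" "Ws ! Suc i = F k" using submodules by auto
      have "F i \<subseteq> F k \<and> irreducible_module (quotient_space (V\<lparr>carrier := F k\<rparr>) (F i))
          (quotient_act (V\<lparr>carrier := F k\<rparr>) act (F i))"
        using Ws Suc.prems unfolding composition_series_def by (metis IH(1) k(2))
      then have "k = Suc i" using le_iff[of i k] cover[of i k] IH k by auto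
      then show ?case using k by simp
    qed
    note nth = this
    have ne: "Ws \<noteq> []" using Ws by (simp add: composition_series_def)
    have "last Ws = F n" using Ws top by (simp add: composition_series_def)
    then have "F (length Ws - 1) = F n" "length Ws - 1 \<le> n"
      using nth[of "length Ws - 1"] ne by (auto simp: last_conv_nth)
    then have "length Ws = Suc n" using inj[of "length Ws - 1" n] ne by (cases Ws) auto
    then show "Ws = map F [0..<Suc n]"
      using nth by (intro nth_equalityI) (auto simp del: upt_Suc)
  next
    assume Ws: "Ws = map F [0..<Suc n]"
    have nth: "Ws ! i = F i" if "i \<le> n" for i
      using that by (simp add: Ws del: upt_Suc)
    have len: "length Ws = Suc n" by (simp add: Ws)
    have ne: "Ws \<noteq> []" using len by auto
    show "composition_series V act Ws"
      unfolding composition_series_def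
    proof (intro conjI allI impI ballI)
      show "Ws \<noteq> []" by (rule ne)
      show "hd Ws = {\<zero>}" using ne nth[of 0] bot by (simp add: hd_conv_nth)
      show "last Ws = carrier V" using ne nth[of n] len top by (simp add: last_conv_nth)
      show "lie_submodule V act W" if "W \<in> set Ws" for W
        using that by (auto simp: Ws flag_submodule simp del: upt_Suc)
      fix i assume i: "Suc i < length Ws"
      show "Ws ! i \<subseteq> Ws ! Suc i" using i mono[of i "Suc i"] by (auto simp: nth len)
      show "irreducible_module (quotient_space (V\<lparr>carrier := Ws ! Suc i\<rparr>) (Ws ! i))
          (quotient_act (V\<lparr>carrier := Ws ! Suc i\<rparr>) act (Ws ! i))"
        using i cover[of i "Suc i"] by (simp add: nth len)
    qed
  qed
qed

end

section \<open>The nilpotent Jordan block and its flag\<close>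

text \<open>
  The span of the first \<open>k\<close> unit vectors, which is the kernel of the \<open>k\<close>-th power of the Jordan
  block of size \<open>m\<close> with eigenvalue 0.
\<close>
definition flag :: "nat \<Rightarrow> nat \<Rightarrow> 'f::zero vec set" where
  "flag m k = {w \<in> carrier_vec m. \<forall>i. k \<le> i \<longrightarrow> i < m \<longrightarrow> w $ i = 0}"

lemma jordan_block_pow_0_index:
  assumes "i < m" "j < m"
  shows "(jordan_block m (0::'f::comm_ring_1) ^\<^sub>m k) $$ (i, j) = (if j = i + k then 1 else 0)"
  using assms by (auto simp: jordan_block_pow power_0_left binomial_eq_0)

text \<open>
  The \<open>k\<close>-th power shifts coordinates down by \<open>k\<close>.
\<close>
lemma jordan_block_pow_mult_vec:
  fixes w :: "'f::comm_ring_1 vec"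
  assumes w: "w \<in> carrier_vec m" and i: "i < m"
  shows "((jordan_block m 0 ^\<^sub>m k) *\<^sub>v w) $ i = (if i + k < m then w $ (i + k) else 0)"
proof -
  have "((jordan_block m 0 ^\<^sub>m k) *\<^sub>v w) $ i
      = (\<Sum>j<m. (jordan_block m 0 ^\<^sub>m k) $$ (i, j) * w $ j)"
    using w i by (simp add: scalar_prod_def atLeast0LessThan)
  also have "\<dots> = (\<Sum>j<m. if j = i + k then w $ j else 0)"
    by (rule sum.cong) (auto simp: i jordan_block_pow_0_index)
  also have "\<dots> = (if i + k < m then w $ (i + k) else 0)" by simp
  finally show ?thesis .
qed

lemma jordan_block_pow_unit_vec:
  assumes "i < m"
  shows "(jordan_block m (0::'f::comm_ring_1) ^\<^sub>m i) *\<^sub>v unit_vec m i = unit_vec m 0"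
  using assms
  by (intro eq_vecI) (auto simp: jordan_block_pow_mult_vec[OF unit_vec_carrier] simp del: index_mult_mat_vec)

lemma jordan_block_pow_vec_eq_0:
  assumes "w \<in> carrier_vec m" "m \<le> k"
  shows "(jordan_block m (0::'f::comm_ring_1) ^\<^sub>m k) *\<^sub>v w = 0\<^sub>v m"
  using assms by (intro eq_vecI) (auto simp: jordan_block_pow_mult_vec simp del: index_mult_mat_vec)

lemma jordan_block_kernel:
  fixes w :: "'f::comm_ring_1 vec"
  assumes w: "w \<in> carrier_vec m" and m: "0 < m" and ker: "jordan_block m 0 *\<^sub>v w = 0\<^sub>v m"
  shows "w = w $ 0 \<cdot>\<^sub>v unit_vec m 0"
proof (rule eq_vecI)
  fix i assume "i < dim_vec (w $ 0 \<cdot>\<^sub>v unit_vec m 0)"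
  then have i: "i < m" by simp
  show "w $ i = (w $ 0 \<cdot>\<^sub>v unit_vec m 0) $ i"
  proof (cases i)
    case (Suc k)
    have "w $ i = ((jordan_block m 0 ^\<^sub>m 1) *\<^sub>v w) $ k"
      using jordan_block_pow_mult_vec[OF w, of k 1] i Suc by simp
    also have "\<dots> = 0" using ker i Suc by simp
    finally show ?thesis using i Suc by simp
  qed (use m in auto)
qed (use w in auto)

text \<open>
  In position \<open>(k, k + i)\<close>, the only place where \<open>J\<^sup>i\<close> has nonzero entries, the commutator picks
  up the factor \<open>(\<alpha> - k) - (\<alpha> - (k + i)) = i\<close>.
\<close>
lemma commutator_diag_jordan_block_pow:
  fixes \<alpha> :: "'f::comm_ring_1" and m i :: nat
  defines "D \<equiv> mat_diag m (\<lambda>k. \<alpha> - of_nat k)"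
  shows "D * (jordan_block m 0 ^\<^sub>m i) - (jordan_block m 0 ^\<^sub>m i) * D
    = of_nat i \<cdot>\<^sub>m (jordan_block m 0 ^\<^sub>m i)"
proof -
  let ?J = "jordan_block m (0::'f) ^\<^sub>m i"
  have J: "?J \<in> carrier_mat m m" by simp
  show ?thesis
    unfolding D_def mat_diag_mult_left[OF J] mat_diag_mult_right[OF J]
  proof (rule eq_matI)
    fix k l assume "k < dim_row (of_nat i \<cdot>\<^sub>m ?J)" "l < dim_col (of_nat i \<cdot>\<^sub>m ?J)"
    then have kl: "k < m" "l < m" using J by (auto simp only: index_smult_mat carrier_matD)
    then show "(mat m m (\<lambda>(k, l). (\<alpha> - of_nat k) * ?J $$ (k, l))
        - mat m m (\<lambda>(k, l). ?J $$ (k, l) * (\<alpha> - of_nat l))) $$ (k, l) = (of_nat i \<cdot>\<^sub>m ?J) $$ (k, l)"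
      using J by (simp add: jordan_block_pow_0_index algebra_simps)
  qed (use J in \<open>auto simp only: index_smult_mat carrier_matD index_minus_mat dim_row_mat dim_col_mat\<close>)
qed

text \<open>
  A matrix supported on or above the \<open>d\<close>-th superdiagonal moves the flag down by \<open>d\<close>. The case
  \<open>d = 0\<close> gives invariance under upper triangular matrices, and \<open>d = 1\<close> gives nilpotency of the strict
  ones.
\<close>
lemma in_flag_mult_vec:
  fixes A :: "'f::comm_ring_1 mat"
  assumes A: "A \<in> carrier_mat m m" and w: "w \<in> flag m k"
    and band: "\<And>i j. i < m \<Longrightarrow> j < i + d \<Longrightarrow> j < m \<Longrightarrow> A $$ (i, j) = 0"
  shows "A *\<^sub>v w \<in> flag m (k - d)"
proof -
  have "(A *\<^sub>v w) $ i = 0" if i: "k - d \<le> i" "i < m" for i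
  proof -
    have "A $$ (i, j) * w $ j = 0" if "j < m" for j
      using w band[OF i(2), of j] that i by (cases "j < i + d") (auto simp: flag_def)
    then show ?thesis using A w i by (auto simp: scalar_prod_def flag_def intro!: sum.neutral)
  qed
  then show ?thesis using A w by (auto simp: flag_def)
qed

lemma flag_Suc_decompose:
  fixes u w :: "'f::field vec"
  assumes "k < m" and u: "u \<in> flag m (Suc k)" and w: "w \<in> flag m (Suc k)" and "w $ k \<noteq> 0"
  shows "u + (- (u $ k / w $ k)) \<cdot>\<^sub>v w \<in> flag m k"
proof -
  have "(u + (- (u $ k / w $ k)) \<cdot>\<^sub>v w) $ i = 0" if "k \<le> i" "i < m" for i
    using assms that by (cases "i = k") (auto simp: flag_def)
  moreover have "u + (- (u $ k / w $ k)) \<cdot>\<^sub>v w \<in> carrier_vec m"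
    using u w by (auto simp: flag_def)
  ultimately show ?thesis unfolding flag_def by blast
qed

lemma flag_subspace: "subspace class_ring (flag m k) (module_vec TYPE('f::field) m)"
proof -
  interpret vec_space "TYPE('f)" m .
  show ?thesis
    unfolding subspace_def submodule_def using vectorspace_axioms module_axioms
    by (auto simp: flag_def module_vec_simps)
qed

lemma flag_psubset:
  assumes "k < l" "l \<le> m"
  shows "(flag m k :: 'f::field vec set) \<subset> flag m l"
proof -
  have "unit_vec m k \<in> flag m l" "(unit_vec m k :: 'f vec) \<notin> flag m k"
    using assms by (auto simp: flag_def)
  moreover have "(flag m k :: 'f vec set) \<subseteq> flag m l" using assms by (auto simp: flag_def)
  ultimately show ?thesis by auto
qed

text \<open>
  Let \<open>k\<close> be least with \<open>W \<subseteq> flag m k\<close>. Some \<open>w \<in> W\<close> then has a nonzero coordinate at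
  \<open>k - 1\<close>, and its shifts \<open>J\<^sup>t w\<close> have their last nonzero coordinates at \<open>k - 1 - t\<close>; by
  elimination from the bottom they generate all of \<open>flag m k\<close>.
\<close>
lemma jordan_block_invariant_subspace:
  fixes W :: "'f::field vec set"
  assumes W: "subspace class_ring W (module_vec TYPE('f) m)"
    and inv: "\<And>w. w \<in> W \<Longrightarrow> jordan_block m 0 *\<^sub>v w \<in> W"
  shows "\<exists>k\<le>m. W = flag m k"
proof -
  interpret vec_space "TYPE('f)" m .
  interpret W: submodule class_ring W V using W by (rule is_module)
  have Wc: "w \<in> carrier_vec m" if "w \<in> W" for w using that W.subset by (auto simp: module_vec_simps)
  have add: "u + w \<in> W" if "u \<in> W" "w \<in> W" for u w
    using W.m_closed[OF that] by (simp add: module_vec_simps)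
  have smult: "c \<cdot>\<^sub>v w \<in> W" if "w \<in> W" for c w
    using W.smult_closed[OF _ that, of c] by (simp add: module_vec_simps class_ring_simps)
  have zero: "0\<^sub>v m \<in> W" using W.zero_closed by (simp add: module_vec_simps)
  have pow: "(jordan_block m 0 ^\<^sub>m j) *\<^sub>v w \<in> W" if "w \<in> W" for j w
    using that
  proof (induction j arbitrary: w)
    case (Suc j)
    have "(jordan_block m 0 ^\<^sub>m Suc j) *\<^sub>v w = (jordan_block m 0 ^\<^sub>m j) *\<^sub>v (jordan_block m 0 *\<^sub>v w)"
      using Wc[OF Suc.prems] by (simp add: assoc_mult_mat_vec[of _ m m _ m])
    then show ?case using Suc inv by simp
  qed (use Wc in simp)
  define k where "k = (LEAST k. W \<subseteq> flag m k)"
  have Wm: "W \<subseteq> flag m m" using Wc by (auto simp: flag_def)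
  have Wk: "W \<subseteq> flag m k" unfolding k_def using Wm by (rule LeastI)
  have km: "k \<le> m" unfolding k_def using Wm by (rule Least_le)
  have "flag m j \<subseteq> W" if "j \<le> k" for j
    using that
  proof (induction j)
    case 0
    have "flag m 0 \<subseteq> {0\<^sub>v m}" by (auto simp: flag_def intro!: eq_vecI)
    then show ?case using zero by auto
  next
    case (Suc j)
    have "\<not> W \<subseteq> flag m (k - 1)"
      using Suc.prems not_less_Least[of "k - 1" "\<lambda>k. W \<subseteq> flag m k"] by (simp add: k_def[symmetric])
    then obtain w where w: "w \<in> W" "w \<notin> flag m (k - 1)" by auto
    have top: "w $ (k - 1) \<noteq> 0"
    proof
      assume 0: "w $ (k - 1) = 0"
      have "w $ i = 0" if "k - 1 \<le> i" "i < m" for i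
        using w(1) Wk that 0 by (cases "i = k - 1") (auto simp: flag_def subset_iff)
      then show False using w Wc by (auto simp: flag_def)
    qed
    \<comment> \<open>The shift moves the nonzero coordinate of \<open>w\<close> from \<open>k - 1\<close> to \<open>j\<close>.\<close>
    define w' where "w' = (jordan_block m 0 ^\<^sub>m (k - 1 - j)) *\<^sub>v w"
    have w'W: "w' \<in> W" unfolding w'_def using w(1) by (rule pow)
    have w'_flag: "w' \<in> flag m (Suc j)"
      using w(1) Wk Wc w'W Suc.prems
      by (auto simp: flag_def w'_def jordan_block_pow_mult_vec subset_iff
          simp del: index_mult_mat_vec)
    have w'_top: "w' $ j \<noteq> 0"
      using top Wc[OF w(1)] Suc.prems km by (auto simp: w'_def jordan_block_pow_mult_vec
        simp del: index_mult_mat_vec)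
    \<comment> \<open>Subtracting a multiple of \<open>w'\<close> clears coordinate \<open>j\<close>, which leaves a vector of \<open>flag m j\<close>.\<close>
    show ?case
    proof
      fix u :: "'f vec" assume u: "u \<in> flag m (Suc j)"
      let ?c = "u $ j / w' $ j"
      have "u + (- ?c) \<cdot>\<^sub>v w' \<in> W"
        using flag_Suc_decompose[OF _ u w'_flag w'_top] Suc.prems Suc.IH km by (meson Suc_le_lessD Suc_leD less_le_trans subsetD)
      then have "(u + (- ?c) \<cdot>\<^sub>v w') + ?c \<cdot>\<^sub>v w' \<in> W" using smult[OF w'W] by (rule add)
      moreover have "(u + (- ?c) \<cdot>\<^sub>v w') + ?c \<cdot>\<^sub>v w' = u"
        using u Wc[OF w'W] by (intro eq_vecI) (auto simp: flag_def)
      ultimately show "u \<in> W" by simp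
    qed
  qed
  then show ?thesis using Wk km by blast
qed

section \<open>Matrix algebra\<close>

lemma smult_diff_distrib_mat:
  fixes A B :: "'f::ring mat"
  assumes "A \<in> carrier_mat n m" "B \<in> carrier_mat n m"
  shows "s \<cdot>\<^sub>m (A - B) = s \<cdot>\<^sub>m A - s \<cdot>\<^sub>m B"
  using assms by (intro eq_matI) (auto simp: right_diff_distrib)

lemma pow_mat_commute:
  fixes A B :: "'f::semiring_1 mat"
  assumes A: "A \<in> carrier_mat n n" and B: "B \<in> carrier_mat n n" and AB: "B * A = A * B"
  shows "B * A ^\<^sub>m k = A ^\<^sub>m k * B"
proof (induction k)
  case (Suc k)
  have Ak: "A ^\<^sub>m k \<in> carrier_mat n n" using A by simp
  have "B * A ^\<^sub>m Suc k = (B * A ^\<^sub>m k) * A" using assoc_mult_mat[OF B Ak A] by simp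
  also have "\<dots> = A ^\<^sub>m k * (A * B)" using assoc_mult_mat[OF Ak B A] Suc AB by simp
  also have "\<dots> = A ^\<^sub>m Suc k * B" using assoc_mult_mat[OF Ak A B] by simp
  finally show ?case .
qed (use A B in simp)

lemma smult_smult_mat: "a \<cdot>\<^sub>m (b \<cdot>\<^sub>m A) = (a * b :: 'f::semigroup_mult) \<cdot>\<^sub>m A"
  by (intro eq_matI) (auto simp: mult.assoc)

text \<open>
  The diagonal of a product of upper triangular matrices is the entrywise product of the diagonals,
  hence the same for both orders.
\<close>
lemma commutator_upper_triangular_strict:
  fixes A B :: "'f::comm_ring_1 mat"
  assumes A: "A \<in> carrier_mat m m" and B: "B \<in> carrier_mat m m"
    and "upper_triangular A" "upper_triangular B" and "j \<le> i" "i < m"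
  shows "(A * B - B * A) $$ (i, j) = 0"
proof -
  have prod: "(A * B) $$ (i, j) = (if i = j then A $$ (i, i) * B $$ (i, i) else 0)"
    if "A \<in> carrier_mat m m" "B \<in> carrier_mat m m" "upper_triangular A" "upper_triangular B"
    for A B :: "'f mat"
  proof -
    have "(A * B) $$ (i, j) = (\<Sum>k<m. A $$ (i, k) * B $$ (k, j))"
      using that assms by (simp add: scalar_prod_def atLeast0LessThan)
    also have "\<dots> = (\<Sum>k<m. if k = i then (if i = j then A $$ (i, i) * B $$ (i, i) else 0) else 0)"
    proof (rule sum.cong)
      fix k assume "k \<in> {..<m}"
      then have k: "k < m" by simp
      consider "k < i" | "k = i" | "i < k" by linarith
      then show "A $$ (i, k) * B $$ (k, j)
          = (if k = i then (if i = j then A $$ (i, i) * B $$ (i, i) else 0) else 0)"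
        using that assms(5,6) k by cases (auto simp: upper_triangularD)
    qed simp
    also have "\<dots> = (if i = j then A $$ (i, i) * B $$ (i, i) else 0)"
      using assms(6) by simp
    finally show ?thesis .
  qed
  show ?thesis using assms prod[of A B] prod[of B A] by (auto simp: mult.commute)
qed

section \<open>Linear maps from a Lie algebra to matrices\<close>

context lie_algebra
begin

lemma br_zero_left [simp]: "br 0 w = 0"
  using br_scale_left[of 0 0 w] by simp

lemma br_zero_right [simp]: "br w 0 = 0"
  using br_scale_right[of w 0 0] by simp

lemma br_anticomm: "br y z = - br z y"
proof -
  have "br (y + z) (y + z) = br y z + br z y"
    unfolding br_add_left br_add_right by (simp add: br_self)
  then show ?thesis by (simp add: br_self eq_neg_iff_add_eq_0)
qed

lemma linear_to_mat_zero:
  assumes "linear_to_mat m G"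
  shows "G 0 = 0\<^sub>m m m"
proof -
  have "G 0 = G (scale 0 0)" by simp
  also have "\<dots> = 0 \<cdot>\<^sub>m G 0" using assms unfolding linear_to_mat_def by blast
  also have "\<dots> = 0\<^sub>m m m"
  proof -
    have "G 0 \<in> carrier_mat m m" using assms by (simp add: linear_to_mat_def)
    then show ?thesis by (intro eq_matI) auto
  qed
  finally show ?thesis .
qed

lemma linear_to_mat_uminus:
  assumes "linear_to_mat m G"
  shows "G (- y) = - G y"
proof -
  have "G (- y) = G (scale (-1) y)" by simp
  also have "\<dots> = (-1) \<cdot>\<^sub>m G y" using assms unfolding linear_to_mat_def by blast
  also have "\<dots> = - G y" by (intro eq_matI) auto
  finally show ?thesis .
qed

text \<open>
  Matrices of a fixed size are not a type, so the uniqueness half of linear extension has to be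
  proved directly; it is what reduces all identities for \<open>R\<close> to a spanning set.
\<close>
lemma linear_to_mat_ext:
  assumes G: "linear_to_mat m G" and H: "linear_to_mat m H"
    and eq: "\<And>b. b \<in> S \<Longrightarrow> G b = H b" and y: "y \<in> span S"
  shows "G y = H y"
proof -
  have "subspace {y. G y = H y}"
    using G H linear_to_mat_zero[OF G] linear_to_mat_zero[OF H]
    by (auto simp: subspace_def linear_to_mat_def)
  from span_induct[OF y this] show ?thesis using eq by auto
qed

lemma linear_to_mat_br_right:
  assumes "linear_to_mat m R"
  shows "linear_to_mat m (\<lambda>z. R (br y z))"
  using assms by (auto simp: linear_to_mat_def br_add_right br_scale_right)

lemma linear_to_mat_br_left:
  assumes "linear_to_mat m R"
  shows "linear_to_mat m (\<lambda>y. R (br y z))"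
  using assms by (auto simp: linear_to_mat_def br_add_left br_scale_left)

lemma linear_to_mat_commutator_right:
  assumes R: "linear_to_mat m R" and A: "A \<in> carrier_mat m m"
  shows "linear_to_mat m (\<lambda>z. A * R z - R z * A)"
proof -
  have c: "R y \<in> carrier_mat m m" for y using R by (simp add: linear_to_mat_def)
  have "A * R (y + z) - R (y + z) * A = A * R y - R y * A + (A * R z - R z * A)" for y z
  proof -
    have "R (y + z) = R y + R z" using R by (simp add: linear_to_mat_def)
    then have "A * R (y + z) = A * R y + A * R z" "R (y + z) * A = R y * A + R z * A"
      using mult_add_distrib_mat[OF A c c, of y z] add_mult_distrib_mat[OF c c A, of y z] by simp_all
    then show ?thesis using A c[of y] c[of z] by (intro eq_matI) auto
  qed
  moreover have "A * R (scale s y) - R (scale s y) * A = s \<cdot>\<^sub>m (A * R y - R y * A)" for s y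
  proof -
    have "R (scale s y) = s \<cdot>\<^sub>m R y" using R by (simp add: linear_to_mat_def)
    then have "A * R (scale s y) = s \<cdot>\<^sub>m (A * R y)" "R (scale s y) * A = s \<cdot>\<^sub>m (R y * A)"
      using A c[of y] by (simp_all add: mult_smult_distrib[of _ m m] mult_smult_assoc_mat[of _ m m])
    then show ?thesis using A c[of y] by (intro eq_matI) (auto simp: right_diff_distrib)
  qed
  moreover have "A * R y - R y * A \<in> carrier_mat m m" for y
    by (rule minus_carrier_mat[OF mult_carrier_mat[OF c A]])
  ultimately show ?thesis by (simp add: linear_to_mat_def)
qed

lemma linear_to_mat_commutator_left:
  assumes R: "linear_to_mat m R" and A: "A \<in> carrier_mat m m"
  shows "linear_to_mat m (\<lambda>y. R y * A - A * R y)"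
proof -
  have c: "R y \<in> carrier_mat m m" for y using R by (simp add: linear_to_mat_def)
  have "R y * A - A * R y = A * R (- y) - R (- y) * A" for y
    using A c[of y] by (intro eq_matI) (auto simp: linear_to_mat_uminus[OF R])
  then have eq: "(\<lambda>y. R y * A - A * R y) = (\<lambda>y. A * R (- y) - R (- y) * A)" by (rule ext)
  have "linear_to_mat m (\<lambda>y. R (- y))"
    using R by (simp only: linear_to_mat_def minus_add_distrib scale_minus_right[symmetric] simp_thms)
  then show ?thesis unfolding eq by (rule linear_to_mat_commutator_right[OF _ A])
qed

lemma matrix_representationI_on_span:
  assumes R: "linear_to_mat m R" and S: "span S = UNIV"
    and gen: "\<And>b c. b \<in> S \<Longrightarrow> c \<in> S \<Longrightarrow> R (br b c) = R b * R c - R c * R b"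
  shows "matrix_representation m R"
proof -
  have c: "R y \<in> carrier_mat m m" for y using R by (simp add: linear_to_mat_def)
  have left: "R (br b z) = R b * R z - R z * R b" if b: "b \<in> S" for b z
  proof (rule linear_to_mat_ext[OF linear_to_mat_br_right[OF R] linear_to_mat_commutator_right[OF R c]])
    show "z \<in> span S" by (simp add: S)
  qed (rule gen[OF b])
  have "R (br y z) = R y * R z - R z * R y" for y z
  proof (rule linear_to_mat_ext[OF linear_to_mat_br_left[OF R] linear_to_mat_commutator_left[OF R c]])
    show "y \<in> span S" by (simp add: S)
  qed (rule left)
  then show ?thesis using R by (simp add: matrix_representation_def)
qed

text \<open>
  The existence half of linear extension, obtained by extending every entry separately as a
  linear functional.
\<close>
lemma linear_to_mat_extend:
  assumes indep: "independent C" and M: "\<And>b. M b \<in> carrier_mat m m"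
  obtains R where "linear_to_mat m R" "\<And>b. b \<in> C \<Longrightarrow> R b = M b"
proof -
  interpret F: vector_space_pair scale "(*) :: 'f \<Rightarrow> 'f \<Rightarrow> 'f"
    by unfold_locales (auto simp: algebra_simps)
  have "\<exists>g. Vector_Spaces.linear scale (*) g \<and> (\<forall>b\<in>C. g b = M b $$ kl)" for kl
    using F.linear_independent_extend[OF indep, of "\<lambda>b. M b $$ kl"] by auto
  then obtain g where g: "\<And>kl. Vector_Spaces.linear scale (*) (g kl)"
    "\<And>kl b. b \<in> C \<Longrightarrow> g kl b = M b $$ kl" by metis
  let ?R = "\<lambda>y. mat m m (\<lambda>kl. g kl y)"
  have "linear_to_mat m ?R"
    unfolding linear_to_mat_def
    by (auto intro!: eq_matI simp: F.linear_add[OF g(1)] F.linear_scale[OF g(1)])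
  moreover have "?R b = M b" if "b \<in> C" for b
    using M[of b] that by (intro eq_matI) (auto simp: g(2))
  ultimately show thesis by (rule that)
qed

text \<open>
  Applying \<open>ad x\<close> multiplies the coefficient at \<open>b\<close> by \<open>d b\<close>. For an eigenvector with eigenvalue
  \<open>\<delta>\<close> this gives \<open>(d b - \<delta>) c\<^sub>b = 0\<close>, so only the \<open>b\<close> with \<open>d b = \<delta>\<close> occur.
\<close>
lemma ad_eigenspace_eq_span:
  assumes indep: "independent B" and eig: "\<And>b. b \<in> B \<Longrightarrow> br x b = scale (d b) b"
  shows "ad_eigenspace x (span B) \<delta> = span {b \<in> B. d b = \<delta>}"
proof
  have "span {b \<in> B. d b = \<delta>} \<subseteq> span B" by (rule span_mono) auto
  moreover have "br x u = scale \<delta> u" if "u \<in> span {b \<in> B. d b = \<delta>}" for u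
  proof -
    have "subspace {u. br x u = scale \<delta> u}"
      by (auto simp: subspace_def br_add_right br_scale_right scale_right_distrib mult.commute)
    from span_induct[OF that this] show ?thesis using eig by auto
  qed
  ultimately show "span {b \<in> B. d b = \<delta>} \<subseteq> ad_eigenspace x (span B) \<delta>"
    by (auto simp: ad_eigenspace_def)
  have coeff: "u \<in> span B \<and> br x u \<in> span B \<and>
      (\<forall>t\<in>B. representation B (br x u) t = d t * representation B u t)"
    if "u \<in> span B" for u
    using that
  proof (induction rule: span_induct_alt)
    case base
    then show ?case by (simp add: span_zero representation_zero)
  next
    case (step c b u)
    have b: "b \<in> span B" using step(1) by (rule span_base)
    have br: "br x (scale c b + u) = scale (c * d b) b + br x u"
      using eig step by (simp add: br_add_right br_scale_right)
    have "representation B (scale (c * d b) b + br x u) t = d t * representation B (scale c b + u) t"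
      if "t \<in> B" for t
      using step that b by (simp add: representation_add[OF indep] representation_scale[OF indep]
          representation_basis[OF indep] span_scale distrib_left)
    then show ?case unfolding br using step b by (simp add: span_add span_scale)
  qed
  show "ad_eigenspace x (span B) \<delta> \<subseteq> span {b \<in> B. d b = \<delta>}"
  proof
    fix u assume "u \<in> ad_eigenspace x (span B) \<delta>"
    then have u: "u \<in> span B" "br x u = scale \<delta> u" by (auto simp: ad_eigenspace_def)
    have "d b = \<delta>" if "representation B u b \<noteq> 0" for b
    proof -
      have "b \<in> B" using that representation_ne_zero by blast
      then have "\<delta> * representation B u b = d b * representation B u b"
        using coeff[OF u(1)] u indep by (simp add: representation_scale)
      then show ?thesis using that by simp
    qed
    then have mem: "b \<in> span {b \<in> B. d b = \<delta>}" if "representation B u b \<noteq> 0" for b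
      using that representation_ne_zero[OF that] by (intro span_base) auto
    have "u = (\<Sum>b | representation B u b \<noteq> 0. scale (representation B u b) b)"
      using sum_nonzero_representation_eq[OF indep u(1)] by simp
    also have "\<dots> \<in> span {b \<in> B. d b = \<delta>}"
      using mem by (intro span_sum span_scale) auto
    finally show "u \<in> span {b \<in> B. d b = \<delta>}" .
  qed
qed

section \<open>Representations by upper triangular matrices\<close>

lemma matrix_representation_lie_module:
  assumes R: "matrix_representation m R"
  shows "lie_module scale br (module_vec TYPE('f) m) (mat_act R)"
proof -
  interpret VS: vec_space "TYPE('f)" m .
  let ?V = "module_vec TYPE('f) m"
  have lin: "linear_to_mat m R" using R by (simp add: matrix_representation_def)
  then have c [simp]: "R y \<in> carrier_mat m m" for y by (simp add: linear_to_mat_def)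
  have minus: "u \<ominus>\<^bsub>?V\<^esub> w = u - w" if "u \<in> carrier_vec m" "w \<in> carrier_vec m" for u w
    using that VS.vec_neg[of w] by (simp add: a_minus_def module_vec_simps minus_add_uminus_vec)
  show ?thesis
  proof (unfold_locales)
    show "mat_act R y \<in> module_hom class_ring ?V ?V" for y
      using mult_mat_vec_carrier[OF c]
      by (auto simp: module_hom_def mat_act_def module_vec_simps
          mult_add_distrib_mat_vec[OF c] mult_mat_vec[OF c])
  next
    fix w y z assume "w \<in> carrier ?V"
    then have w: "w \<in> carrier_vec m" by (simp add: module_vec_simps)
    show "mat_act R (y + z) w = mat_act R y w \<oplus>\<^bsub>?V\<^esub> mat_act R z w"
      using lin add_mult_distrib_mat_vec[OF c c w]
      by (simp add: mat_act_def module_vec_simps linear_to_mat_def)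
    show "mat_act R (br y z) w = mat_act R y (mat_act R z w) \<ominus>\<^bsub>?V\<^esub> mat_act R z (mat_act R y w)"
      using R w
      by (simp add: mat_act_def minus matrix_representation_def mult_carrier_mat[OF c c]
          mult_mat_vec_carrier[OF c] minus_mult_distrib_mat_vec[of _ m m] assoc_mult_mat_vec[of _ m m _ m])
  next
    fix w s y assume "w \<in> carrier ?V"
    then have w: "w \<in> carrier_vec m" by (simp add: module_vec_simps)
    have "(s \<cdot>\<^sub>m R y) *\<^sub>v w = s \<cdot>\<^sub>v (R y *\<^sub>v w)"
      using w carrier_matD[OF c, of y]
      by (intro eq_vecI) (auto simp: smult_scalar_prod_distrib[of _ m])
    then show "mat_act R (scale s y) w = s \<odot>\<^bsub>?V\<^esub> mat_act R y w"
      using lin by (simp add: mat_act_def module_vec_simps linear_to_mat_def)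
  qed
qed

lemma derived_algebra_strictly_upper_triangular:
  assumes R: "matrix_representation m R" and up: "\<And>y. upper_triangular (R y)"
    and y: "y \<in> derived_algebra" and ij: "j \<le> i" "i < m"
  shows "R y $$ (i, j) = 0"
proof -
  have lin: "linear_to_mat m R" using R by (simp add: matrix_representation_def)
  have c: "R y \<in> carrier_mat m m" for y using lin by (simp add: linear_to_mat_def)
  have d: "dim_row (R y) = m" "dim_col (R y) = m" for y using carrier_matD[OF c] by auto
  have "subspace {y. R y $$ (i, j) = 0}"
    using lin linear_to_mat_zero[OF lin] ij by (simp add: subspace_def linear_to_mat_def d)
  moreover have "R z $$ (i, j) = 0" if "z \<in> {br y z | y z. True}" for z
    using that R commutator_upper_triangular_strict[OF c c up up ij]
    by (auto simp: matrix_representation_def)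
  ultimately show ?thesis
    using y span_induct[of y "{br y z | y z. True}" "\<lambda>y. R y $$ (i, j) = 0"]
    unfolding derived_algebra_def by blast
qed

lemma upper_triangular_admissible:
  assumes R: "matrix_representation m R" and up: "\<And>y. upper_triangular (R y)"
  shows "admissible (module_vec TYPE('f) m) (mat_act R)"
  unfolding admissible_def
proof (intro ballI exI[of _ m])
  fix y w assume y: "y \<in> derived_algebra" and "w \<in> carrier (module_vec TYPE('f) m)"
  then have w: "w \<in> flag m m" by (simp add: flag_def module_vec_simps)
  have c: "R y \<in> carrier_mat m m" using R by (simp add: matrix_representation_def linear_to_mat_def)
  have "(mat_act R y ^^ k) w \<in> flag m (m - k)" for k
  proof (induction k)
    case (Suc k)
    then show ?case
      using in_flag_mult_vec[OF c, of _ "m - k" 1] derived_algebra_strictly_upper_triangular[OF R up y]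
      by (simp add: mat_act_def less_Suc_eq_le)
  qed (use w in simp)
  from this[of m] show "(mat_act R y ^^ m) w = \<zero>\<^bsub>module_vec TYPE('f) m\<^esub>"
    by (auto simp: flag_def module_vec_simps)
qed

text \<open>
  Upper triangularity of all \<open>R y\<close> makes every member of the flag a submodule; the Jordan block among
  them excludes any other submodule.
\<close>
lemma upper_triangular_jordan_composition_series:
  assumes R: "matrix_representation m R" and up: "\<And>y. upper_triangular (R y)"
    and jordan: "R v = jordan_block m 0"
  shows "composition_series (module_vec TYPE('f) m) (mat_act R) Ws \<longleftrightarrow> Ws = map (flag m) [0..<Suc m]"
proof -
  let ?V = "module_vec TYPE('f) m"
  interpret U: lie_module scale br ?V "mat_act R"
    using R by (rule matrix_representation_lie_module)
  interpret LA: linear_action ?V "mat_act R"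
    using U.vs U.act_hom unfolding linear_action_def linear_action_axioms_def module_hom_def by blast
  have c: "R y \<in> carrier_mat m m" for y
    using R by (simp add: matrix_representation_def linear_to_mat_def)
  have "R y *\<^sub>v w \<in> flag m k" if "w \<in> flag m k" for y w k
    using in_flag_mult_vec[OF c that, of 0] up carrier_matD[OF c]
    by (auto simp: upper_triangular_def)
  then have "lie_submodule ?V (mat_act R) (flag m k)" for k
    using flag_subspace by (auto simp: lie_submodule_def mat_act_def)
  moreover have "\<exists>k\<le>m. W = flag m k" if "lie_submodule ?V (mat_act R) W" for W
    using that by (intro jordan_block_invariant_subspace) (auto simp: lie_submodule_def mat_act_def simp flip: jordan)
  ultimately have "lie_submodule ?V (mat_act R) W \<longleftrightarrow> (\<exists>k\<le>m. W = flag m k)" for W by blast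
  moreover have "flag m 0 = {\<zero>\<^bsub>?V\<^esub>}" "flag m m = carrier ?V"
    by (auto simp: flag_def module_vec_simps intro!: eq_vecI)
  ultimately show ?thesis by (intro LA.composition_series_flag_iff flag_psubset)
qed

end

section \<open>The representation attached to the data\<close>

lemma of_nat_inj_below_CHAR:
  assumes "CHAR('f::semiring_1_cancel) = 0 \<or> m \<le> CHAR('f)" "i < m" "j < m"
  shows "(of_nat i :: 'f) = of_nat j \<longleftrightarrow> i = j"
  using assms by (auto simp: of_nat_eq_iff_cong_CHAR cong_def)

text \<open>
  The setting of the theorem. The eigenvector \<open>v\<close> is part of it since its existence forces
  \<open>x \<noteq> 0\<close>, without which \<open>x\<close> would not extend a basis of \<open>\<aa>\<close>.
\<close>
locale diagonal_extension = lie_algebra scale br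
  for scale :: "'f::field \<Rightarrow> 'g::ab_group_add \<Rightarrow> 'g" and br +
  fixes x v :: 'g and \<aa> :: "'g set"
  assumes semidirect: "semidirect x \<aa>" and ad_diagonalizable: "ad_diagonalizable_on x \<aa>"
    and v_eigen: "v \<in> ad_eigenspace x \<aa> 1" and v_nonzero: "v \<noteq> 0"
begin

lemma eigenbasis:
  obtains B d where "independent B" "span B = \<aa>" "\<And>b. b \<in> B \<Longrightarrow> b \<in> ad_eigenspace x \<aa> (d b)"
    "x \<notin> B" "independent (insert x B)" "span (insert x B) = UNIV"
proof -
  obtain B d where B: "independent B" "span B = \<aa>" "\<And>b. b \<in> B \<Longrightarrow> br x b = scale (d b) b"
    using ad_diagonalizable unfolding ad_diagonalizable_on_def by metis
  have x: "x \<notin> \<aa>"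
  proof
    assume "x \<in> \<aa>"
    then have "x \<in> span {x} \<inter> \<aa>" by (simp add: span_base)
    then have "x = 0" using semidirect by (auto simp: semidirect_def)
    then show False using v_eigen v_nonzero by (simp add: ad_eigenspace_def)
  qed
  have "y \<in> span (insert x B)" for y
  proof -
    obtain t u where "t \<in> span {x}" "u \<in> span B" "y = t + u"
      using semidirect B(2) unfolding semidirect_def by metis
    then show ?thesis
      using span_mono[of "{x}" "insert x B"] span_mono[of B "insert x B"] by (auto intro!: span_add)
  qed
  moreover have "x \<notin> B" using x B(2) span_superset by blast
  moreover have "independent (insert x B)" using B x by (simp add: independent_insertI)
  moreover have "b \<in> ad_eigenspace x \<aa> (d b)" if "b \<in> B" for b
    using that B span_superset by (auto simp: ad_eigenspace_def)
  ultimately show thesis using B(1,2) by (intro that[of B d]) auto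
qed

lemma is_R_mapD:
  assumes "is_R_map x \<aa> m \<alpha> f R"
  shows "linear_to_mat m R" and "R x = mat_diag m (\<lambda>k. \<alpha> - of_nat k)"
    and "i < m \<Longrightarrow> u \<in> ad_eigenspace x \<aa> (of_nat i) \<Longrightarrow> R u = f i u \<cdot>\<^sub>m (jordan_block m 0 ^\<^sub>m i)"
    and "\<delta> \<notin> of_nat ` {..<m} \<Longrightarrow> u \<in> ad_eigenspace x \<aa> \<delta> \<Longrightarrow> R u = 0\<^sub>m m m"
  using assms unfolding is_R_map_def by blast+

text \<open>
  A uniform description of \<open>R\<close> on eigenvectors: the two clauses of the definition merge once the value
  zero is read as \<open>0 \<cdot> J\<^sup>0\<close>.
\<close>
lemma is_R_map_eigen:
  assumes R: "is_R_map x \<aa> m \<alpha> f R" and u: "u \<in> ad_eigenspace x \<aa> \<delta>"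
  obtains c i where "R u = c \<cdot>\<^sub>m (jordan_block m 0 ^\<^sub>m i)" "c \<noteq> 0 \<Longrightarrow> \<delta> = of_nat i"
proof (cases "\<delta> \<in> of_nat ` {..<m}")
  case True
  then obtain i where "i < m" "\<delta> = of_nat i" by auto
  then show thesis using R u that[of "f i u" i] by (auto simp: is_R_map_def)
next
  case False
  have zero: "0\<^sub>m m m = 0 \<cdot>\<^sub>m (jordan_block m (0::'f) ^\<^sub>m 0)" by (intro eq_matI) auto
  have "R u = 0\<^sub>m m m" using R u False unfolding is_R_map_def by blast
  then show thesis using that[of 0 0] unfolding zero by blast
qed

lemma is_R_map_unique:
  assumes R: "is_R_map x \<aa> m \<alpha> f R" and R': "is_R_map x \<aa> m \<alpha> f R'"
  shows "R = R'"
proof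
  fix y
  note D = is_R_mapD[OF R] and D' = is_R_mapD[OF R']
  obtain B d where eig: "\<And>b. b \<in> B \<Longrightarrow> b \<in> ad_eigenspace x \<aa> (d b)"
    and UNIV: "span (insert x B) = UNIV"
    using eigenbasis by metis
  have "R b = R' b" if "b \<in> B" for b
  proof (cases "d b \<in> of_nat ` {..<m}")
    case True
    then obtain i where i: "i < m" "d b = of_nat i" by auto
    then have "b \<in> ad_eigenspace x \<aa> (of_nat i)" using eig[OF that] by simp
    then show ?thesis using D(3)[OF i(1)] D'(3)[OF i(1)] by simp
  next
    case False
    show ?thesis using D(4)[OF False eig[OF that]] D'(4)[OF False eig[OF that]] by simp
  qed
  then have "R b = R' b" if "b \<in> insert x B" for b
    using that D(2) D'(2) by (cases "b = x") auto
  then show "R y = R' y"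
    by (rule linear_to_mat_ext[OF D(1) D'(1), of "insert x B"]) (simp_all add: UNIV)
qed

text \<open>
  Extend linearly from \<open>x\<close> and an eigenbasis. On \<open>\<aa>(i)\<close> both \<open>R\<close> and \<open>f\<^sup>i(\<cdot>) J\<^sup>i\<close> are linear
  and agree on the basis vectors with eigenvalue \<open>i\<close>, which span \<open>\<aa>(i)\<close>.
\<close>
lemma is_R_map_exists:
  assumes valid: "valid_data x \<aa> v m f"
  shows "\<exists>R. is_R_map x \<aa> m \<alpha> f R"
proof -
  obtain B d where indep: "independent B" and span: "span B = \<aa>"
    and eig: "\<And>b. b \<in> B \<Longrightarrow> b \<in> ad_eigenspace x \<aa> (d b)"
    and x: "x \<notin> B" and indep': "independent (insert x B)"
    using eigenbasis by metis
  define M where "M b = (if b = x then mat_diag m (\<lambda>k. \<alpha> - of_nat k)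
      else if \<exists>i<m. d b = of_nat i
        then let i = (THE i. i < m \<and> d b = of_nat i) in f i b \<cdot>\<^sub>m (jordan_block m 0 ^\<^sub>m i)
      else 0\<^sub>m m m)" for b
  have "M b \<in> carrier_mat m m" for b by (auto simp: M_def Let_def)
  then obtain R where R: "linear_to_mat m R" "\<And>b. b \<in> insert x B \<Longrightarrow> R b = M b"
    using linear_to_mat_extend[OF indep'] by metis
  have eigenspace: "ad_eigenspace x \<aa> \<delta> = span {b \<in> B. d b = \<delta>}" for \<delta>
    using ad_eigenspace_eq_span[OF indep, of x d] eig span by (simp add: ad_eigenspace_def)
  have "R u = f i u \<cdot>\<^sub>m (jordan_block m 0 ^\<^sub>m i)"
    if i: "i < m" and u: "u \<in> ad_eigenspace x \<aa> (of_nat i)" for i u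
  proof -
    let ?E = "ad_eigenspace x \<aa> (of_nat i)" 
    define J where "J = jordan_block m (0::'f) ^\<^sub>m i"
    have E: "subspace ?E" unfolding eigenspace by (rule subspace_span)
    have f: "f i (u + w) = f i u + f i w" "f i (scale c u) = c * f i u" if "u \<in> ?E" "w \<in> ?E" for c u w
      using valid i that by (auto simp: valid_data_def linear_functional_on_def)
    have J: "J \<in> carrier_mat m m" by (simp add: J_def)
    have zero: "f i 0 = 0" using f(2)[of 0 0 0] subspace_0[OF E] by simp
    have "R u = f i u \<cdot>\<^sub>m J \<and> u \<in> ?E"
      using u[unfolded eigenspace]
    proof (induction rule: span_induct_alt)
      case base
      then show ?case using J subspace_0[OF E] by (auto simp: zero linear_to_mat_zero[OF R(1)] intro!: eq_matI)
    next
      case (step c b u)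
      then have b: "b \<in> B" "d b = of_nat i" by auto
      \<comment> \<open>The bound on the characteristic makes the index of the eigenvalue unambiguous.\<close>
      have "(THE k. k < m \<and> d b = of_nat k) = i"
        using i b valid by (intro the_equality) (auto simp: valid_data_def of_nat_inj_below_CHAR[of m])
      then have Rb: "R b = f i b \<cdot>\<^sub>m J" using R(2)[of b] b x i by (auto simp: M_def J_def)
      have bE: "b \<in> ?E" using eig[OF b(1)] b(2) by simp
      have "R (scale c b + u) = c \<cdot>\<^sub>m R b + R u" using R(1) by (simp add: linear_to_mat_def)
      also have "\<dots> = (c * f i b + f i u) \<cdot>\<^sub>m J"
        using J step by (auto simp: Rb distrib_right intro!: eq_matI)
      also have "c * f i b + f i u = f i (scale c b + u)"
        using f bE step subspace_scale[OF E bE, of c] by simp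
      finally show ?case using step bE E by (simp add: subspace_add subspace_scale)
    qed
    then show ?thesis by (simp add: J_def)
  qed
  moreover have "R u = 0\<^sub>m m m" if \<delta>: "\<delta> \<notin> of_nat ` {..<m}" and u: "u \<in> ad_eigenspace x \<aa> \<delta>" for \<delta> u
  proof (rule linear_to_mat_ext[OF R(1), of "\<lambda>_. 0\<^sub>m m m"])
    show "u \<in> span {b \<in> B. d b = \<delta>}" using u by (simp add: eigenspace)
    show "linear_to_mat m (\<lambda>_. 0\<^sub>m m m)" by (auto simp: linear_to_mat_def intro!: eq_matI)
    show "R b = 0\<^sub>m m m" if "b \<in> {b \<in> B. d b = \<delta>}" for b
      using that \<delta> x R(2)[of b] by (auto simp: M_def)
  qed
  moreover have "R x = mat_diag m (\<lambda>k. \<alpha> - of_nat k)" using R(2)[of x] by (simp add: M_def)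
  ultimately show ?thesis using R(1) by (auto simp: is_R_map_def)
qed

text \<open>
  On the basis, the bracket relation for \<open>x\<close> and an eigenvector is the commutator formula for \<open>D\<close>
  and \<open>J\<^sup>i\<close>, and for two eigenvectors it says that powers of \<open>J\<close> commute.
\<close>
lemma is_R_map_representation:
  assumes R: "is_R_map x \<aa> m \<alpha> f R"
  shows "matrix_representation m R"
proof -
  let ?D = "mat_diag m (\<lambda>k. \<alpha> - of_nat k)" and ?J = "\<lambda>i. jordan_block m (0::'f) ^\<^sub>m i"
  have lin: "linear_to_mat m R" and Rx: "R x = ?D" using is_R_mapD[OF R] by auto
  have c [simp]: "R y \<in> carrier_mat m m" for y using lin by (simp add: linear_to_mat_def)
  have d [simp]: "dim_row (R y) = m" "dim_col (R y) = m" for y using carrier_matD[OF c] by auto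
  have J: "?J i \<in> carrier_mat m m" for i by simp
  obtain B d where eig: "\<And>b. b \<in> B \<Longrightarrow> b \<in> ad_eigenspace x \<aa> (d b)"
    and UNIV: "span (insert x B) = UNIV"
    using eigenbasis by metis
  have xb: "R (br x b) = R x * R b - R b * R x" if b: "b \<in> B" for b
  proof -
    obtain s i where s: "R b = s \<cdot>\<^sub>m ?J i" "s \<noteq> 0 \<Longrightarrow> d b = of_nat i"
      using is_R_map_eigen[OF R eig[OF b]] by metis
    have "R x * R b - R b * R x = s \<cdot>\<^sub>m (?D * ?J i) - s \<cdot>\<^sub>m (?J i * ?D)"
      unfolding Rx s(1) mult_smult_distrib[OF mat_diag_dim J] mult_smult_assoc_mat[OF J mat_diag_dim] ..
    also have "\<dots> = s \<cdot>\<^sub>m (?D * ?J i - ?J i * ?D)"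
      by (rule smult_diff_distrib_mat[OF mult_carrier_mat[OF mat_diag_dim J]
          mult_carrier_mat[OF J mat_diag_dim], symmetric])
    also have "\<dots> = s \<cdot>\<^sub>m (of_nat i \<cdot>\<^sub>m ?J i)"
      by (simp only: commutator_diag_jordan_block_pow)
    also have "\<dots> = d b \<cdot>\<^sub>m (s \<cdot>\<^sub>m ?J i)"
      using s(2) by (cases "s = 0") (auto intro!: eq_matI)
    also have "\<dots> = R (scale (d b) b)" using lin s(1) by (simp add: linear_to_mat_def)
    also have "scale (d b) b = br x b" using eig[OF b] by (simp add: ad_eigenspace_def)
    finally show ?thesis by simp
  qed
  have "R (br b b') = R b * R b' - R b' * R b" if "b \<in> insert x B" "b' \<in> insert x B" for b b'
  proof -
    consider "b = x" "b' = x" | "b = x" "b' \<in> B" | "b \<in> B" "b' = x" | "b \<in> B" "b' \<in> B"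
      using \<open>b \<in> insert x B\<close> \<open>b' \<in> insert x B\<close> by auto
    then show ?thesis
    proof cases
      case 1
      then show ?thesis by (auto simp: br_self linear_to_mat_zero[OF lin] intro!: eq_matI)
    next
      case 2
      then show ?thesis using xb by simp
    next
      case 3
      then have "R (br b b') = - (R x * R b - R b * R x)"
        using xb[of b] br_anticomm[of b x] linear_to_mat_uminus[OF lin] by simp
      then show ?thesis using 3 by (auto intro!: eq_matI)
    next
      case 4
      have "br b b' = 0"
        using 4 eig semidirect by (auto simp: ad_eigenspace_def semidirect_def abelian_ideal_def)
      moreover have "R b * R b' = R b' * R b"
      proof -
        obtain s i t j where "R b = s \<cdot>\<^sub>m ?J i" "R b' = t \<cdot>\<^sub>m ?J j"
          using is_R_map_eigen[OF R eig] 4 by metis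
        moreover have "?J i * ?J j = ?J j * ?J i"
          using pow_mat_commute[OF jordan_block_carrier jordan_block_carrier refl, of m "0::'f" i]
          by (intro pow_mat_commute[OF jordan_block_carrier J]) simp
        ultimately show ?thesis
          by (simp add: mult_smult_distrib[OF J J] mult_smult_distrib[OF smult_carrier_mat[OF J] J]
              mult_smult_assoc_mat[OF J J] smult_smult_mat mult.commute)
      qed
      ultimately show ?thesis by (auto simp: linear_to_mat_zero[OF lin] intro!: eq_matI)
    qed
  qed
  then show ?thesis using lin UNIV by (intro matrix_representationI_on_span[where S = "insert x B"])
qed

lemma is_R_map_upper_triangular:
  assumes R: "is_R_map x \<aa> m \<alpha> f R"
  shows "upper_triangular (R y)"
proof (rule upper_triangularI)
  fix i j assume ij: "j < i" "i < dim_row (R y)"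
  have lin: "linear_to_mat m R" and Rx: "R x = mat_diag m (\<lambda>k. \<alpha> - of_nat k)"
    using is_R_mapD[OF R] by auto
  have c: "R y \<in> carrier_mat m m" for y using lin by (simp add: linear_to_mat_def)
  have d: "dim_row (R y) = m" "dim_col (R y) = m" for y using carrier_matD[OF c] by auto
  have im: "i < m" using ij by (simp add: d)
  obtain B d where eig: "\<And>b. b \<in> B \<Longrightarrow> b \<in> ad_eigenspace x \<aa> (d b)"
    and UNIV: "span (insert x B) = UNIV"
    using eigenbasis by metis
  have "subspace {y. R y $$ (i, j) = 0}"
    using lin linear_to_mat_zero[OF lin] ij im by (simp add: subspace_def linear_to_mat_def d)
  moreover have "R b $$ (i, j) = 0" if "b \<in> insert x B" for b
  proof (cases "b = x")
    case True
    then show ?thesis using ij im Rx by (simp add: mat_diag_def)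
  next
    case False
    then have "b \<in> B" using that by simp
    then obtain s k where "R b = s \<cdot>\<^sub>m (jordan_block m 0 ^\<^sub>m k)"
      using is_R_map_eigen[OF R eig] by metis
    then show ?thesis using ij im by (simp add: jordan_block_pow_0_index)
  qed
  ultimately show "R y $$ (i, j) = 0"
    using span_induct[of y "insert x B" "\<lambda>y. R y $$ (i, j) = 0"] UNIV by blast
qed

lemma is_R_map_v:
  assumes R: "is_R_map x \<aa> m \<alpha> f R" and valid: "valid_data x \<aa> v m f"
  shows "R v = jordan_block m 0"
proof -
  have "R v = f 1 v \<cdot>\<^sub>m (jordan_block m 0 ^\<^sub>m 1)"
  proof -
    have "v \<in> ad_eigenspace x \<aa> (of_nat 1)" using v_eigen by simp
    then show ?thesis using R valid unfolding is_R_map_def valid_data_def by blast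
  qed
  also have "\<dots> = jordan_block m 0"
    using valid by (intro eq_matI) (auto simp: valid_data_def)
  finally show ?thesis .
qed

section \<open>The data are determined by the module\<close>

text \<open>
  Everything is read off from the line killed by \<open>v\<close>: the isomorphism maps \<open>e\<^sub>0\<close> to a nonzero
  vector on the corresponding line, and \<open>e\<^sub>0 = J\<^sup>i e\<^sub>i\<close> is reached from every \<open>e\<^sub>i\<close> by powers
  of \<open>v\<close>.
\<close>
lemma isomorphic_R_modules_same_data:
  assumes R: "is_R_map x \<aa> m \<alpha> f R" and valid: "valid_data x \<aa> v m f"
    and R': "is_R_map x \<aa> m' \<alpha>' f' R'" and valid': "valid_data x \<aa> v m' f'"
    and iso: "isomorphic_modules (module_vec TYPE('f) m) (mat_act R) (module_vec TYPE('f) m') (mat_act R')"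
  shows "m' = m \<and> \<alpha>' = \<alpha> \<and> (\<forall>i<m. \<forall>u\<in>ad_eigenspace x \<aa> (of_nat i). f' i u = f i u)"
proof -
  let ?J = "jordan_block m (0::'f)" and ?J' = "jordan_block m' (0::'f)"
  let ?e = "unit_vec m :: nat \<Rightarrow> 'f vec"
  obtain \<phi> where hom: "\<phi> \<in> module_hom class_ring (module_vec TYPE('f) m) (module_vec TYPE('f) m')"
    and bij: "bij_betw \<phi> (carrier_vec m) (carrier_vec m')"
    and act: "\<And>y w. w \<in> carrier_vec m \<Longrightarrow> \<phi> (R y *\<^sub>v w) = R' y *\<^sub>v \<phi> w"
    using iso unfolding isomorphic_modules_def mat_act_def module_vec_simps by blast
  have \<phi>_closed: "\<phi> w \<in> carrier_vec m'" if "w \<in> carrier_vec m" for w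
    using hom that by (auto simp: module_hom_def module_vec_simps)
  have \<phi>_smult: "\<phi> (c \<cdot>\<^sub>v w) = c \<cdot>\<^sub>v \<phi> w" if "w \<in> carrier_vec m" for c w
    using hom that by (auto simp: module_hom_def module_vec_simps)
  have \<phi>_zero: "\<phi> (0\<^sub>v m) = 0\<^sub>v m'"
  proof -
    have "\<phi> (0\<^sub>v m) = \<phi> (0 \<cdot>\<^sub>v 0\<^sub>v m)" by (rule arg_cong[where f = \<phi>]) auto
    also have "\<dots> = 0 \<cdot>\<^sub>v \<phi> (0\<^sub>v m)" by (rule \<phi>_smult) simp
    also have "\<dots> = 0\<^sub>v m'" using \<phi>_closed[of "0\<^sub>v m"] by (intro eq_vecI) auto
    finally show ?thesis .
  qed
  have \<phi>_eq_zero: "w = 0\<^sub>v m" if "w \<in> carrier_vec m" "\<phi> w = 0\<^sub>v m'" for w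
    using bij that \<phi>_zero by (metis bij_betw_def inj_on_eq_iff zero_carrier_vec)
  have m: "0 < m" "0 < m'" using valid valid' by (auto simp: valid_data_def)
  have pow: "\<phi> ((?J ^\<^sub>m k) *\<^sub>v w) = (?J' ^\<^sub>m k) *\<^sub>v \<phi> w" if "w \<in> carrier_vec m" for k w
    using that
  proof (induction k arbitrary: w)
    case (Suc k)
    have "(?J ^\<^sub>m Suc k) *\<^sub>v w = (?J ^\<^sub>m k) *\<^sub>v (?J *\<^sub>v w)"
      using Suc.prems by (simp add: assoc_mult_mat_vec[of _ m m _ m])
    moreover have "?J *\<^sub>v w \<in> carrier_vec m"
      using Suc.prems by (intro mult_mat_vec_carrier) auto
    moreover have "\<phi> (?J *\<^sub>v w) = ?J' *\<^sub>v \<phi> w"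
      using act[OF Suc.prems, of v] by (simp add: is_R_map_v[OF R valid] is_R_map_v[OF R' valid'])
    ultimately show ?case
      using Suc.IH \<phi>_closed[OF Suc.prems] by (simp add: assoc_mult_mat_vec[of _ m' m' _ m'])
  qed (use \<phi>_closed in simp)
  have e0: "?e 0 \<noteq> 0\<^sub>v m" "(unit_vec m' 0 :: 'f vec) \<noteq> 0\<^sub>v m'"
    using m by (auto dest!: arg_cong[where f = "\<lambda>w. w $ 0"])
  have \<phi>e0: "\<phi> (?e 0) \<noteq> 0\<^sub>v m'" using \<phi>_eq_zero[of "?e 0"] e0 by auto
  \<comment> \<open>In the longer block a unit vector survives as many steps as kill everything in the shorter one.\<close>
  have "m' = m"
  proof (rule linorder_cases)
    assume less: "m' < m"
    have "\<phi> (?e 0) = (?J' ^\<^sub>m m') *\<^sub>v \<phi> (?e m')"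
      using pow[of "?e m'" m'] less by (simp add: jordan_block_pow_unit_vec)
    also have "\<dots> = 0\<^sub>v m'" by (intro jordan_block_pow_vec_eq_0 \<phi>_closed) simp_all
    finally show ?thesis using \<phi>e0 by simp
  next
    assume less: "m < m'"
    obtain w where w: "w \<in> carrier_vec m" "\<phi> w = unit_vec m' m"
      using bij less by (metis bij_betw_def imageE unit_vec_carrier)
    have "unit_vec m' 0 = \<phi> ((?J ^\<^sub>m m) *\<^sub>v w)"
      using pow[OF w(1), of m] w(2) less by (simp add: jordan_block_pow_unit_vec)
    also have "\<dots> = 0\<^sub>v m'" using jordan_block_pow_vec_eq_0[OF w(1), of m] \<phi>_zero by simp
    finally show ?thesis using e0 by simp
  qed
  moreover have "\<alpha>' = \<alpha>"
  proof -
    have diag: "mat_diag n (\<lambda>k. \<beta> - of_nat k) *\<^sub>v unit_vec n 0 = \<beta> \<cdot>\<^sub>v unit_vec n 0" if "0 < n"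
      for n and \<beta> :: 'f
      using that by (intro eq_vecI) (auto simp: mat_diag_def)
    have "?J' *\<^sub>v \<phi> (?e 0) = \<phi> (?J *\<^sub>v ?e 0)" using pow[of "?e 0" 1] by simp
    also have "?J *\<^sub>v ?e 0 = 0\<^sub>v m" using m by (intro eq_vecI) auto
    finally have "?J' *\<^sub>v \<phi> (?e 0) = 0\<^sub>v m'" by (simp add: \<phi>_zero)
    then obtain c where c: "\<phi> (?e 0) = c \<cdot>\<^sub>v unit_vec m' 0"
      using jordan_block_kernel[OF \<phi>_closed m(2)] by (metis unit_vec_carrier)
    have "\<alpha> \<cdot>\<^sub>v \<phi> (?e 0) = \<phi> (R x *\<^sub>v ?e 0)"
      using is_R_mapD(2)[OF R] m by (simp add: diag \<phi>_smult)
    also have "\<dots> = R' x *\<^sub>v (c \<cdot>\<^sub>v unit_vec m' 0)" using act[of "?e 0" x] c by simp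
    also have "\<dots> = c \<cdot>\<^sub>v (\<alpha>' \<cdot>\<^sub>v unit_vec m' 0)"
      using is_R_mapD(2)[OF R'] m by (simp add: mult_mat_vec[of _ m' m'] diag)
    finally have eq: "\<alpha> \<cdot>\<^sub>v (c \<cdot>\<^sub>v unit_vec m' 0) = c \<cdot>\<^sub>v (\<alpha>' \<cdot>\<^sub>v unit_vec m' 0)"
      unfolding c .
    have "\<alpha> * c = \<alpha>' * c"
      using m arg_cong[OF eq, of "\<lambda>w. w $ 0"] by (simp add: mult.commute)
    moreover have "c \<noteq> 0" using \<phi>e0 c by auto
    ultimately show ?thesis by simp
  qed
  moreover have "f' i u = f i u" if i: "i < m" and u: "u \<in> ad_eigenspace x \<aa> (of_nat i)" for i u
  proof -
    have smult: "(c \<cdot>\<^sub>m A) *\<^sub>v w = c \<cdot>\<^sub>v (A *\<^sub>v w)"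
      if "A \<in> carrier_mat n n" "w \<in> carrier_vec n" for c and A :: "'f mat" and w n
      using that by (intro eq_vecI) (auto simp: smult_scalar_prod_distrib[of _ n])
    have "f i u \<cdot>\<^sub>v \<phi> (?e 0) = \<phi> (R u *\<^sub>v ?e i)"
      using i by (simp add: is_R_mapD(3)[OF R i u] smult[of _ m] jordan_block_pow_unit_vec \<phi>_smult)
    also have "\<dots> = f' i u \<cdot>\<^sub>v ((?J' ^\<^sub>m i) *\<^sub>v \<phi> (?e i))"
      using i u \<open>m' = m\<close> act[of "?e i" u] is_R_mapD(3)[OF R', of i u] \<phi>_closed[of "?e i"]
      by (simp add: smult[of _ m])
    also have "(?J' ^\<^sub>m i) *\<^sub>v \<phi> (?e i) = \<phi> (?e 0)"
      using pow[of "?e i" i] i by (simp add: jordan_block_pow_unit_vec)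
    finally have eq: "f i u \<cdot>\<^sub>v \<phi> (?e 0) = f' i u \<cdot>\<^sub>v \<phi> (?e 0)" .
    obtain j where j: "j < m'" "\<phi> (?e 0) $ j \<noteq> 0"
    proof (rule ccontr)
      assume "\<not> thesis"
      then have "\<phi> (?e 0) = 0\<^sub>v m'" using that \<phi>_closed[of "?e 0"] by (intro eq_vecI) auto
      then show False using \<phi>e0 by simp
    qed
    have "f i u * \<phi> (?e 0) $ j = f' i u * \<phi> (?e 0) $ j"
      using arg_cong[OF eq, of "\<lambda>w. w $ j"] j \<phi>_closed[of "?e 0"] by simp
    then show ?thesis using j by simp
  qed
  ultimately show ?thesis by blast
qed

lemma R_module_properties:
  assumes R: "is_R_map x \<aa> m \<alpha> f R" and valid: "valid_data x \<aa> v m f"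
  shows "uniserial (module_vec TYPE('f) m) (mat_act R)"
    and "has_composition_length (module_vec TYPE('f) m) (mat_act R) m"
    and "\<exists>y\<in>derived_algebra. \<exists>w\<in>carrier (module_vec TYPE('f) m). mat_act R y w \<noteq> \<zero>\<^bsub>module_vec TYPE('f) m\<^esub>"
proof -
  note rep = is_R_map_representation[OF R] and up = is_R_map_upper_triangular[OF R]
    and jordan = is_R_map_v[OF R valid]
  note series = upper_triangular_jordan_composition_series[OF rep up jordan]
  show "uniserial (module_vec TYPE('f) m) (mat_act R)"
    unfolding uniserial_def series by blast
  show "has_composition_length (module_vec TYPE('f) m) (mat_act R) m"
    unfolding has_composition_length_def series by simp
  have m: "1 < m" using valid by (simp add: valid_data_def)
  have "br x v = v" using v_eigen by (simp add: ad_eigenspace_def)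
  then have "v \<in> derived_algebra" unfolding derived_algebra_def by (intro span_base CollectI exI[of _ x] exI[of _ v]) simp
  moreover have "mat_act R v (unit_vec m 1) = unit_vec m 0"
    using jordan_block_pow_unit_vec[of 1 m] m by (simp add: mat_act_def jordan)
  moreover have "(unit_vec m 0 :: 'f vec) \<noteq> 0\<^sub>v m"
    using m by (auto dest!: arg_cong[where f = "\<lambda>w. w $ 0"])
  ultimately show "\<exists>y\<in>derived_algebra. \<exists>w\<in>carrier (module_vec TYPE('f) m). mat_act R y w \<noteq> \<zero>\<^bsub>module_vec TYPE('f) m\<^esub>"
    unfolding module_vec_simps by (metis unit_vec_carrier)
qed

end

theorem proposition3p3:
  fixes scale :: "'f::alg_closed_field \<Rightarrow> 'g::ab_group_add \<Rightarrow> 'g"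
    and br :: "'g \<Rightarrow> 'g \<Rightarrow> 'g"
    and x v :: 'g and \<aa> :: "'g set"
    and m :: nat and \<alpha> :: 'f and f :: "nat \<Rightarrow> 'g \<Rightarrow> 'f"
  assumes "lie_algebra scale br"
    and "lie_algebra.finite_dim scale"
    and "lie_algebra.semidirect scale br x \<aa>"
    and "lie_algebra.ad_diagonalizable_on scale br x \<aa>"
    and "v \<in> lie_algebra.ad_eigenspace scale br x \<aa> 1" and "v \<noteq> 0"
    and "lie_algebra.valid_data scale br x \<aa> v m f"
  shows "(\<exists>!R. lie_algebra.is_R_map scale br x \<aa> m \<alpha> f R) \<and>
    (\<forall>R. lie_algebra.is_R_map scale br x \<aa> m \<alpha> f R \<longrightarrow>
       lie_algebra.matrix_representation scale br m R \<and>
       lie_module scale br (module_vec TYPE('f) m) (mat_act R) \<and>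
       lie_algebra.admissible scale br (module_vec TYPE('f) m) (mat_act R) \<and>
       uniserial (module_vec TYPE('f) m) (mat_act R) \<and>
       has_composition_length (module_vec TYPE('f) m) (mat_act R) m \<and>
       (\<exists>y\<in>lie_algebra.derived_algebra scale br.
          \<exists>w\<in>carrier (module_vec TYPE('f) m). mat_act R y w \<noteq> \<zero>\<^bsub>module_vec TYPE('f) m\<^esub>)) \<and>
    (\<forall>R m' \<alpha>' f' R'.
       lie_algebra.is_R_map scale br x \<aa> m \<alpha> f R \<and>
       lie_algebra.valid_data scale br x \<aa> v m' f' \<and>
       lie_algebra.is_R_map scale br x \<aa> m' \<alpha>' f' R' \<and>
       isomorphic_modules (module_vec TYPE('f) m) (mat_act R)
         (module_vec TYPE('f) m') (mat_act R') \<longrightarrow>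
       m' = m \<and> \<alpha>' = \<alpha> \<and>
       (\<forall>i<m. \<forall>u\<in>lie_algebra.ad_eigenspace scale br x \<aa> (of_nat i). f' i u = f i u))"
proof -
  interpret lie_algebra scale br by (rule assms(1))
  interpret diagonal_extension scale br x v \<aa>
    using assms(3-6) by unfold_locales
  note valid = assms(7)
  have "\<exists>!R. is_R_map x \<aa> m \<alpha> f R"
    using is_R_map_exists[OF valid] is_R_map_unique by blast
  moreover have "matrix_representation m R \<and>
      lie_module scale br (module_vec TYPE('f) m) (mat_act R) \<and>
      admissible (module_vec TYPE('f) m) (mat_act R) \<and>
      uniserial (module_vec TYPE('f) m) (mat_act R) \<and>
      has_composition_length (module_vec TYPE('f) m) (mat_act R) m \<and>
      (\<exists>y\<in>derived_algebra. \<exists>w\<in>carrier (module_vec TYPE('f) m).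
        mat_act R y w \<noteq> \<zero>\<^bsub>module_vec TYPE('f) m\<^esub>)"
    if R: "is_R_map x \<aa> m \<alpha> f R" for R
  proof -
    have rep: "matrix_representation m R" using R by (rule is_R_map_representation)
    show ?thesis
      using rep matrix_representation_lie_module[OF rep]
        upper_triangular_admissible[OF rep is_R_map_upper_triangular[OF R]]
        R_module_properties[OF R valid]
      by (intro conjI)
  qed
  moreover have "m' = m \<and> \<alpha>' = \<alpha> \<and> (\<forall>i<m. \<forall>u\<in>ad_eigenspace x \<aa> (of_nat i). f' i u = f i u)"
    if "is_R_map x \<aa> m \<alpha> f R \<and> valid_data x \<aa> v m' f' \<and> is_R_map x \<aa> m' \<alpha>' f' R' \<and>
      isomorphic_modules (module_vec TYPE('f) m) (mat_act R) (module_vec TYPE('f) m') (mat_act R')"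
    for R m' \<alpha>' f' R'
    using that isomorphic_R_modules_same_data[OF _ valid] by blast
  ultimately show ?thesis by blast
qed

end
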